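(* Let $n \ge 2$, $m\ge 2$ be integers and $p$ a prime with $\gcd(n,p)=1$; if $p=2$, assume $m\ge 3$. Let $G = (C_n \times C_{p^m}) \rtimes_\alpha C_p$ be an $SMC(n,m,p)$ with $\alpha(y) \equiv \beta p^{m-1}+1 \bmod p^m$ for some $\beta\in\{1,\dots,p-1\}$. 1) If $p$ is odd, then $$\mathrm{Spec}_R(G) = \left\{ p^{e+1} + p^{e-1}(\Sigma(d)-p) \;\middle|\; 0\le e\le m-1,\ d\in D(np,p),\ \big(d_1\cdots d_p\equiv 0 \bmod p \iff e = m-1\big)\right\}.$$ 2) If $p=2$ and $n\not\equiv 0\bmod 3$, then $$\mathrm{Spec}_R(G) = \left\{ 2^{e+1} + 2^{e-1}(\Sigma(d)-2) \;\middle|\; 1\le e\le m-1,\ d\in D(2n,2),\ \big(d_1 d_2\equiv 0 \bmod 2 \iff e = m-1\big)\right\}.$$ 3) If $p=2$ and $n\equiv 0 \bmod 3$, then $\mathrm{Spec}_R(G)$ is given by the formula of 2) with $D(2n,2)$ replaced by $D'(2n,2)$.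
   Context: For a group $G$ and $\varphi \in \mathrm{Aut}(G)$, elements $g_1,g_2\in G$ are $\varphi$-conjugate if $g_1 = g g_2 \varphi(g)^{-1}$ for some $g\in G$; the Reidemeister number $R(\varphi)$ is the number of equivalence classes of this relation, and $\mathrm{Spec}_R(G) = \{R(\varphi) \mid \varphi\in \mathrm{Aut}(G)\}$. $C_k$ denotes the cyclic group of order $k$. An $SMC(n,m,p)$ is any semidirect product $(C_n\times C_{p^m})\rtimes_\alpha C_p$ (with $n\ge1$, $m\ge 0$, $p$ prime, $\gcd(n,p)=1$, $\alpha: C_p \to \mathrm{Aut}(C_n\times C_{p^m})$ a homomorphism) where $C_p$ acts freely by automorphisms on $C_n$, i.e. the only element of $C_n$ fixed by all of $C_p$ is the identity. Put $N=np^m$ and $C_N = C_n\times C_{p^m}$; $x,y$ are fixed generators of $C_N$ and $C_p$, and $\alpha(y)$ is regarded as an integer modulo $N$ via $x^y = y^{-1}xy = x^{\alpha(y)}$. For positive integers $a,b$: $D(a,b)$ is the set of tuples $(d_1,\dots,d_b)\in \mathbb{Z}_{\ge 0}^b$ such that each $d_i$ divides $a$ and $\gcd(d_i,d_j)=1$ for all $i\ne j$; $D'(a,b)$ is the set of $(d_1,\dots,d_b)\in D(a,b)$ such that $d_i\equiv 0 \bmod 3$ for some $i$. For $d=(d_1,\dots,d_b)$, $\Sigma(d) = \sum_{i=1}^{b} d_i$ (here $b=p$). *)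

theory Defs
  imports "HOL-Algebra.Algebra" "HOL-Number_Theory.Number_Theory"
begin

(* Only the values of \<phi> on carrier G matter. Automorphisms are the elements of auto G, which are
   extensional functions, so that distinct functions are distinct automorphisms. *)
definition twisted_conj_rel :: "('a, 'b) monoid_scheme \<Rightarrow> ('a \<Rightarrow> 'a) \<Rightarrow> ('a \<times> 'a) set" where
  "twisted_conj_rel G \<phi> =
     {(g1, g2). g1 \<in> carrier G \<and> g2 \<in> carrier G \<and>
        (\<exists>g\<in>carrier G. g1 = g \<otimes>\<^bsub>G\<^esub> g2 \<otimes>\<^bsub>G\<^esub> inv\<^bsub>G\<^esub> (\<phi> g))}"

(* Meaningful when there are finitely many classes, in particular for every finite group;
   card yields the junk value 0 when there are infinitely many. *)
definition reidemeister_number :: "('a, 'b) monoid_scheme \<Rightarrow> ('a \<Rightarrow> 'a) \<Rightarrow> nat" where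
  "reidemeister_number G \<phi> = card (carrier G // twisted_conj_rel G \<phi>)"

definition reidemeister_spectrum :: "('a, 'b) monoid_scheme \<Rightarrow> nat set" where
  "reidemeister_spectrum G = reidemeister_number G ` auto G"

(* The pair (h, k) stands for the product h k. The action convention is \<alpha> k h = k\<^sup>-\<^sup>1 h k, whence
   h1 k1 h2 k2 = h1 (k1 h2 k1\<^sup>-\<^sup>1) k1 k2 with k1 h2 k1\<^sup>-\<^sup>1 = \<alpha> (inv k1) h2. With this convention a
   homomorphism \<alpha> : K \<rightarrow> Aut H yields a group because K is assumed commutative; for general K
   an antihomomorphism would be needed. *)
definition semidirect_product ::
  "('a, 'c) monoid_scheme \<Rightarrow> ('b, 'd) monoid_scheme \<Rightarrow> ('b \<Rightarrow> 'a \<Rightarrow> 'a) \<Rightarrow> ('a \<times> 'b) monoid" where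
  "semidirect_product H K \<alpha> =
     \<lparr>carrier = carrier H \<times> carrier K,
      monoid.mult = (\<lambda>(h1, k1) (h2, k2). (h1 \<otimes>\<^bsub>H\<^esub> \<alpha> (inv\<^bsub>K\<^esub> k1) h2, k1 \<otimes>\<^bsub>K\<^esub> k2)),
      one = (\<one>\<^bsub>H\<^esub>, \<one>\<^bsub>K\<^esub>)\<rparr>"

lemma AutoGroup_homD:
  assumes "group H" "group K" "\<alpha> \<in> hom K (AutoGroup H)"
  shows "k \<in> carrier K \<Longrightarrow> \<alpha> k \<in> hom H H"
    and "k \<in> carrier K \<Longrightarrow> h \<in> carrier H \<Longrightarrow> \<alpha> k h \<in> carrier H"
    and "k \<in> carrier K \<Longrightarrow> l \<in> carrier K \<Longrightarrow> h \<in> carrier H \<Longrightarrow> \<alpha> (k \<otimes>\<^bsub>K\<^esub> l) h = \<alpha> k (\<alpha> l h)"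
    and "h \<in> carrier H \<Longrightarrow> \<alpha> \<one>\<^bsub>K\<^esub> h = h"
proof -
  have au: "\<alpha> k \<in> auto H" if "k \<in> carrier K" for k
    using assms(3) that by (auto simp: hom_def AutoGroup_def)
  show 1: "\<alpha> k \<in> hom H H" if "k \<in> carrier K" for k
    using au[OF that] by (simp add: auto_def)
  show "\<alpha> k h \<in> carrier H" if "k \<in> carrier K" "h \<in> carrier H" for k h
    using 1[OF that(1)] that(2) by (auto simp: hom_def)
  show "\<alpha> (k \<otimes>\<^bsub>K\<^esub> l) h = \<alpha> k (\<alpha> l h)"
    if "k \<in> carrier K" "l \<in> carrier K" "h \<in> carrier H" for k l h
  proof -
    have "\<alpha> (k \<otimes>\<^bsub>K\<^esub> l) = compose (carrier H) (\<alpha> k) (\<alpha> l)"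
      using assms(3) that au[of k] au[of l]
      by (auto simp: hom_def AutoGroup_def BijGroup_def auto_def)
    thus ?thesis using that by (simp add: compose_def)
  qed
  interpret group_hom K "AutoGroup H" \<alpha>
    using assms group.AutoGroup by (simp add: group_hom_def group_hom_axioms_def)
  show "\<alpha> \<one>\<^bsub>K\<^esub> h = h" if "h \<in> carrier H" for h
    using hom_one that by (simp add: AutoGroup_def BijGroup_def)
qed

lemma group_semidirect_product:
  assumes H: "group H" and K: "comm_group K" and \<alpha>: "\<alpha> \<in> hom K (AutoGroup H)"
  shows "group (semidirect_product H K \<alpha>)"
proof -
  interpret H: group H by (fact H)
  interpret K: comm_group K by (fact K)
  note [simp] = AutoGroup_homD[OF H K.is_group \<alpha>]
  have mlt: "\<alpha> k (g \<otimes>\<^bsub>H\<^esub> h) = \<alpha> k g \<otimes>\<^bsub>H\<^esub> \<alpha> k h"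
    if "k \<in> carrier K" "g \<in> carrier H" "h \<in> carrier H" for k g h
    using hom_mult[of "\<alpha> k" H H] that by simp
  have iv: "\<alpha> k (inv\<^bsub>H\<^esub> g) \<otimes>\<^bsub>H\<^esub> \<alpha> k g = \<one>\<^bsub>H\<^esub>" if "k \<in> carrier K" "g \<in> carrier H" for k g
    using that H.is_group by (metis AutoGroup_homD(1)[OF H K.is_group \<alpha>] H.inv_closed H.l_inv mlt hom_one)
  show ?thesis
  proof (rule groupI)
    fix x assume "x \<in> carrier (semidirect_product H K \<alpha>)"
    then obtain h k where x: "x = (h, k)" "h \<in> carrier H" "k \<in> carrier K"
      by (auto simp: semidirect_product_def)
    show "\<exists>y\<in>carrier (semidirect_product H K \<alpha>).
        y \<otimes>\<^bsub>semidirect_product H K \<alpha>\<^esub> x = \<one>\<^bsub>semidirect_product H K \<alpha>\<^esub>"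
      by (rule bexI[of _ "(\<alpha> k (inv\<^bsub>H\<^esub> h), inv\<^bsub>K\<^esub> k)"])
        (use x iv in \<open>auto simp: semidirect_product_def\<close>)
  qed (auto simp: semidirect_product_def mlt H.m_assoc K.m_assoc K.inv_mult
        simp flip: AutoGroup_homD(3)[OF H K.is_group \<alpha>])
qed

lemma semidirect_product_conj:
  fixes H (structure) and K (structure)
  assumes H: "group H" and K: "comm_group K" and \<alpha>: "\<alpha> \<in> hom K (AutoGroup H)"
    and h: "h \<in> carrier H" and k: "k \<in> carrier K"
  defines "G \<equiv> semidirect_product H K \<alpha>"
  shows "inv\<^bsub>G\<^esub> (\<one>\<^bsub>H\<^esub>, k) \<otimes>\<^bsub>G\<^esub> (h, \<one>\<^bsub>K\<^esub>) \<otimes>\<^bsub>G\<^esub> (\<one>\<^bsub>H\<^esub>, k) = (\<alpha> k h, \<one>\<^bsub>K\<^esub>)"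
proof -
  interpret H: group H by (fact H)
  interpret K: comm_group K by (fact K)
  interpret G: group G unfolding G_def by (rule group_semidirect_product[OF H K \<alpha>])
  note [simp] = AutoGroup_homD[OF H K.is_group \<alpha>]
  have o: "\<alpha> l \<one>\<^bsub>H\<^esub> = \<one>\<^bsub>H\<^esub>" if "l \<in> carrier K" for l
    using that H by (meson AutoGroup_homD(1)[OF H K.is_group \<alpha>] hom_one)
  have "inv\<^bsub>G\<^esub> (\<one>\<^bsub>H\<^esub>, k) = (\<one>\<^bsub>H\<^esub>, inv\<^bsub>K\<^esub> k)"
    by (rule G.inv_equality) (use k o in \<open>auto simp: G_def semidirect_product_def\<close>)
  thus ?thesis using h k o by (auto simp: G_def semidirect_product_def)
qed

abbreviation smc_base :: "nat \<Rightarrow> nat \<Rightarrow> nat \<Rightarrow> (int \<times> int) monoid" where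
  "smc_base n m p \<equiv> integer_mod_group n \<times>\<times> integer_mod_group (p ^ m)"

definition smc_action :: "nat \<Rightarrow> nat \<Rightarrow> nat \<Rightarrow> (int \<Rightarrow> int \<times> int \<Rightarrow> int \<times> int) \<Rightarrow> bool" where
  "smc_action n m p \<alpha> \<longleftrightarrow>
     n \<ge> 1 \<and> Factorial_Ring.prime p \<and> gcd n p = 1 \<and>
     \<alpha> \<in> hom (integer_mod_group p) (AutoGroup (smc_base n m p)) \<and>
     (\<forall>u\<in>carrier (integer_mod_group n).
        (\<forall>c\<in>carrier (integer_mod_group p).
           \<alpha> c (u, \<one>\<^bsub>integer_mod_group (p ^ m)\<^esub>) = (u, \<one>\<^bsub>integer_mod_group (p ^ m)\<^esub>)) \<longrightarrow>
        u = \<one>\<^bsub>integer_mod_group n\<^esub>)"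

definition smc :: "nat \<Rightarrow> nat \<Rightarrow> nat \<Rightarrow> (int \<Rightarrow> int \<times> int \<Rightarrow> int \<times> int) \<Rightarrow> ((int \<times> int) \<times> int) monoid" where
  "smc n m p \<alpha> = semidirect_product (smc_base n m p) (integer_mod_group p) \<alpha>"

definition coprime_divisor_tuples :: "nat \<Rightarrow> nat \<Rightarrow> nat list set" where
  "coprime_divisor_tuples a b =
     {d. length d = b \<and> (\<forall>i<b. d ! i dvd a) \<and> (\<forall>i<b. \<forall>j<b. i \<noteq> j \<longrightarrow> gcd (d ! i) (d ! j) = 1)}"

definition coprime_divisor_tuples3 :: "nat \<Rightarrow> nat \<Rightarrow> nat list set" where
  "coprime_divisor_tuples3 a b = {d \<in> coprime_divisor_tuples a b. \<exists>i<b. [d ! i = 0] (mod 3)}"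

end

theory Submission
  imports Defs
begin

text \<open>
  Let \<open>N = n p\<^sup>m\<close>, let \<open>x\<close> generate \<open>C\<^sub>N\<close>, and let \<open>z = y\<^sup>-\<^sup>1\<close>, so that \<open>z x z\<^sup>-\<^sup>1 = x\<^sup>b\<close> with \<open>b = \<alpha>(y)\<close>. Every element
  of the group is \<open>x\<^sup>i z\<^sup>j\<close>.

  Automorphisms. The subgroup \<open>C\<^sub>N\<close> is the centraliser of the Hall subgroup \<open>C\<^sub>n\<close>, hence characteristic,
  so an automorphism maps \<open>x\<close> to \<open>x\<^sup>s\<close> for a unit \<open>s\<close> modulo \<open>N\<close>. It maps \<open>z\<close> to some \<open>x\<^sup>t z\<close>, and as this has order
  \<open>p\<close>, the exponent \<open>t\<close> is a multiple of \<open>p\<^bsup>m-1\<^esup> = gcd(b - 1, N)\<close>. Exactly these \<open>t\<close> arise from inner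
  automorphisms, which do not change Reidemeister numbers. So only \<open>s\<close> matters
  (\<open>auto_normal_form\<close>), and every unit \<open>s\<close> occurs (\<open>ex_auto_scaling_base\<close>).

  Classes. Twisted conjugation preserves each coset \<open>C\<^sub>N z\<^sup>j\<close>. On exponents it consists of adding multiples
  of \<open>1 - s b\<^sup>j\<close> and multiplying by \<open>b\<close>, so the classes in this coset are the orbits of \<open>b\<close> on the residues
  modulo \<open>D\<^sub>j = gcd(1 - s b\<^sup>j, N)\<close> (\<open>reidemeister_number_formula\<close>). An orbit has \<open>1\<close> or \<open>p\<close> elements, and there are
  \<open>gcd(b - 1, D\<^sub>j)\<close> fixed points. This number does not depend on \<open>j\<close>: it is \<open>p\<^sup>e = gcd(1 - s, p\<^bsup>m-1\<^esup>)\<close>, because \<open>b\<close> is \<open>1\<close> modulo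
  \<open>p\<^bsup>m-1\<^esup>\<close>. With \<open>D\<^sub>j = p\<^sup>e d\<^sub>j\<close>, summing over \<open>j\<close> gives \<open>p R = p\<^sup>e (\<Sigma>(d) + p (p - 1))\<close>, which is the stated value.

  Tuples. It remains to see which pairs \<open>(e, d)\<close> arise from units \<open>s\<close>. A common divisor of \<open>D\<^sub>i\<close> and \<open>D\<^sub>j\<close> divides
  \<open>b\<^bsup>j-i\<^esup> - 1\<close> and therefore \<open>b - 1\<close>, since \<open>b\<close> has prime order; so the \<open>d\<^sub>j\<close> are pairwise coprime. The prime \<open>p\<close> divides
  some \<open>d\<^sub>j\<close> if and only if \<open>e = m - 1\<close>, because the powers of \<open>b\<close> modulo \<open>p\<^sup>m\<close> are exactly the residues that are \<open>1\<close> modulo \<open>p\<^bsup>m-1\<^esup>\<close>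
  (\<open>unit_realises_admissible\<close>). Conversely, \<open>s\<close> can be prescribed independently at each prime power by the
  Chinese remainder theorem (\<open>admissible_realised\<close>). At a prime \<open>q\<close> dividing \<open>n\<close>, one may choose the index \<open>j\<close> with
  \<open>s b\<^sup>j\<close> close to \<open>1\<close>, or decide that there is none; the latter needs a unit that is not a power of \<open>b\<close> modulo
  \<open>q\<close>. Such a unit is missing only if \<open>q - 1 = p\<close>, that is \<open>p = 2\<close> and \<open>q = 3\<close>, which is where the condition
  modulo \<open>3\<close> comes from. For \<open>p = 2\<close> the unit \<open>s\<close> is odd, so \<open>e = 0\<close> is impossible.
\<close>

section \<open>Greatest common divisors and residues\<close>

lemma gcd_prime_power_obtain:
  fixes x :: int and p m :: nat
  assumes "Factorial_Ring.prime p"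
  obtains k where "k \<le> m" "gcd x (int (p ^ m)) = int (p ^ k)"
proof -
  have "gcd x (int (p ^ m)) dvd int p ^ m"
    using gcd_dvd2[of x "int (p ^ m)"] by simp
  moreover have "Factorial_Ring.prime (int p)"
    using assms by simp
  ultimately obtain k where "k \<le> m" "normalize (gcd x (int (p ^ m))) = int p ^ k"
    using divides_primepow by blast
  thus ?thesis using that by simp
qed

lemma gcd_prime_power_eqI:
  fixes x :: int and p m :: nat
  assumes p: "Factorial_Ring.prime p" and dvd: "int (p ^ e) dvd x" and "e \<le> m"
    and not_dvd: "e < m \<Longrightarrow> \<not> int (p ^ (e + 1)) dvd x"
  shows "gcd x (int (p ^ m)) = int (p ^ e)"
proof -
  obtain k where k: "k \<le> m" "gcd x (int (p ^ m)) = int (p ^ k)"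
    using gcd_prime_power_obtain[OF p] .
  have "int (p ^ e) dvd int (p ^ k)"
    unfolding k(2)[symmetric] using dvd le_imp_power_dvd[OF \<open>e \<le> m\<close>, of p]
    by (intro gcd_greatest) (simp_all only: int_dvd_int_iff)
  hence "e \<le> k"
    using prime_gt_1_nat[OF p] by (simp only: int_dvd_int_iff) (simp add: dvd_power_iff_le prime_ge_2_nat[OF p])
  moreover have "\<not> e < k"
  proof
    assume "e < k"
    hence "int (p ^ (e + 1)) dvd int (p ^ k)"
      using le_imp_power_dvd[of "e + 1" k p] by (simp only: int_dvd_int_iff)
    also have "\<dots> dvd x"
      unfolding k(2)[symmetric] by (rule gcd_dvd1)
    finally show False using not_dvd \<open>e < k\<close> k(1) by simp
  qed
  ultimately show ?thesis using k(2) by simp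
qed

text \<open>
  The Chinese remainder theorem at the level of greatest common divisors: the part of \<open>x\<close> in
  \<open>a * b\<close> splits into the parts in \<open>a\<close> and in \<open>b\<close>.
\<close>

lemma gcd_coprime_mult:
  fixes x a b :: int
  assumes "coprime a b"
  shows "gcd x (a * b) = gcd x a * gcd x b"
proof (rule zdvd_antisym_nonneg)
  obtain g h where gh: "gcd x (a * b) = g * h" "g dvd a" "h dvd b"
    using division_decomp[OF gcd_dvd2[of x "a * b"]] by blast
  have "g dvd x" "h dvd x"
    using gcd_dvd1[of x "a * b"] unfolding gh(1) by (auto dest: dvd_mult_left dvd_mult_right)
  with gh show "gcd x (a * b) dvd gcd x a * gcd x b"
    by (auto intro!: mult_dvd_mono)
next
  have "coprime (gcd x a) (gcd x b)"
    using assms by (metis coprime_divisors gcd_dvd2)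
  hence "gcd x a * gcd x b dvd x"
    by (intro divides_mult) auto
  thus "gcd x a * gcd x b dvd gcd x (a * b)"
    by (auto intro: mult_dvd_mono)
qed auto

lemma gcd_mult_eqI:
  fixes t x q r :: int
  assumes "coprime q r" "gcd t q = gcd x q" "gcd t r = gcd x r"
  shows "gcd t (q * r) = gcd x (q * r)"
  using assms by (simp add: gcd_coprime_mult)

text \<open>
  The set of multiples of \<open>t\<close> modulo \<open>N\<close> is the set of multiples of \<open>gcd t N\<close>. This is how a
  quantifier over \<open>r\<close> turns into one congruence.
\<close>

lemma ex_dvd_diff_mult_iff:
  fixes t N w :: int
  shows "(\<exists>r. N dvd w - r * t) \<longleftrightarrow> gcd t N dvd w"
proof
  assume "\<exists>r. N dvd w - r * t"
  then obtain r where "N dvd w - r * t" by blast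
  hence "gcd t N dvd (w - r * t) + r * t"
    by (intro dvd_add) (auto intro: dvd_trans[OF gcd_dvd2])
  thus "gcd t N dvd w" by simp
next
  assume "gcd t N dvd w"
  then obtain c where c: "w = gcd t N * c" by (elim dvdE)
  obtain u where "[t * u = gcd t N] (mod N)"
    using cong_solve_int by blast
  hence "[t * u * c = gcd t N * c] (mod N)" by (rule cong_scalar_right)
  hence "N dvd w - (u * c) * t"
    unfolding c by (simp add: cong_iff_dvd_diff dvd_diff_commute mult_ac)
  thus "\<exists>r. N dvd w - r * t" by blast
qed

text \<open>
  With \<open>g = gcd c D\<close>, the residues killed by \<open>c\<close> are the multiples of \<open>D / g\<close>, and there are \<open>g\<close> of
  them below \<open>D\<close>. For \<open>c = b - 1\<close> these are the fixed points of multiplication by \<open>b\<close>.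
\<close>

lemma card_annihilated_residues:
  fixes c D :: int
  assumes "D > 0"
  shows "int (card {w \<in> {0..<D}. D dvd c * w}) = gcd c D"
proof -
  define g where "g = gcd c D"
  have g: "g > 0" using assms by (simp add: g_def)
  obtain c' D' where c': "c = g * c'" and D': "D = g * D'"
    unfolding g_def by (meson dvdE gcd_dvd1 gcd_dvd2)
  have "coprime c' D'"
    using g c' D' by (metis g_def gcd_coprime less_irrefl mult.commute mult_cancel_left)
  hence iff: "D dvd c * w \<longleftrightarrow> D' dvd w" for w
    using g unfolding c' D' by (simp add: mult.assoc coprime_commute coprime_dvd_mult_right_iff)
  have D'_pos: "D' > 0"
    using assms g D' by (simp add: zero_less_mult_iff)
  have "{w \<in> {0..<D}. D dvd c * w} = (\<lambda>t. D' * t) ` {0..<g}"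
    unfolding iff by (use D'_pos in \<open>auto simp: D' dvd_def mult.commute zero_le_mult_iff\<close>)
  also have "card \<dots> = card {0..<g}"
    using D'_pos by (intro card_image inj_onI) auto
  finally show ?thesis using g by (simp add: g_def)
qed

lemma prime_dvd_prod_list_iff:
  fixes p :: nat
  assumes "Factorial_Ring.prime p"
  shows "p dvd prod_list d \<longleftrightarrow> (\<exists>i<length d. p dvd d ! i)"
proof -
  have "p dvd prod_list d \<longleftrightarrow> (\<exists>x\<in>set d. p dvd x)"
    using assms by (induction d) (auto simp: prime_dvd_mult_iff)
  thus ?thesis by (metis in_set_conv_nth)
qed

section \<open>Units of order p with a linear p-part\<close>

text \<open>
  The integer \<open>b\<close> is the exponent through which a generator of \<open>C\<^sub>p\<close> acts on \<open>C\<^sub>N\<close>, where \<open>N = n p\<^sup>m\<close>.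
  Coprimality of \<open>b - 1\<close> and \<open>n\<close> expresses that the action on \<open>C\<^sub>n\<close> is free, and the last two assumptions
  that \<open>b\<close> is congruent to \<open>\<beta> p\<^bsup>m-1\<^esup> + 1\<close> modulo \<open>p\<^sup>m\<close> with \<open>\<beta>\<close> prime to \<open>p\<close>.
\<close>

locale unit_of_order_p =
  fixes n m p :: nat and b :: int
  assumes prime_p: "Factorial_Ring.prime p"
    and n_ge_2: "n \<ge> 2"
    and m_ge_2: "m \<ge> 2"
    and m_ge_3: "p = 2 \<Longrightarrow> m \<ge> 3"
    and coprime_n_p: "coprime n p"
    and power_p_cong_1: "[b ^ p = 1] (mod int (n * p ^ m))"
    and coprime_pred_n: "coprime (b - 1) (int n)"
    and p_part_dvd_pred: "int (p ^ (m - 1)) dvd b - 1"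
    and p_part_not_dvd_pred: "\<not> int (p ^ m) dvd b - 1"
begin

abbreviation N :: int where "N \<equiv> int (n * p ^ m)"

lemma p_pos: "p > 0" and p_ge_2: "p \<ge> 2"
  using prime_p prime_gt_0_nat prime_ge_2_nat by auto

lemma N_pos: "N > 0"
  using n_ge_2 p_pos by simp

lemma power_cong_of_exponent_cong:
  assumes "[i = j] (mod p)" "D dvd N"
  shows "[b ^ i = b ^ j] (mod D)"
proof -
  have red: "[b ^ k = b ^ (k mod p)] (mod D)" for k
  proof -
    have "[(b ^ p) ^ (k div p) = 1 ^ (k div p)] (mod D)"
      by (intro cong_pow cong_dvd_modulus[OF power_p_cong_1 \<open>D dvd N\<close>])
    hence "[b ^ (p * (k div p)) * b ^ (k mod p) = 1 * b ^ (k mod p)] (mod D)"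
      by (intro cong_scalar_right) (simp add: power_mult)
    thus ?thesis by (simp flip: power_add)
  qed
  show ?thesis
    using red[of i] red[of j] assms(1) by (metis cong_def)
qed

lemma coprime_b: "D dvd N \<Longrightarrow> coprime b D"
proof -
  assume "D dvd N"
  hence "[b * b ^ (p - 1) = 1] (mod D)"
    using cong_dvd_modulus[OF power_p_cong_1] p_pos by (simp flip: power_Suc)
  thus "coprime b D" by (meson coprime_iff_invertible_int)
qed

text \<open>
  As \<open>p\<close> is prime, every power \<open>b\<^sup>k\<close> with \<open>k\<close> prime to \<open>p\<close> generates the same group as \<open>b\<close>, so it has
  the same fixed points. This replaces all arguments with the multiplicative order of \<open>b\<close>
  modulo single primes.
\<close>

lemma power_fixes_imp_fixes:
  assumes D: "D dvd N" and k: "\<not> p dvd k" and fixed: "[b ^ k * w = w] (mod D)"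
  shows "[b * w = w] (mod D)"
proof -
  have "coprime k p"
    using k prime_p by (metis coprime_commute prime_imp_coprime_nat)
  then obtain u where u: "[k * u = 1] (mod p)"
    using cong_solve_coprime_nat by auto
  have iter: "[b ^ (k * v) * w = w] (mod D)" for v
  proof (induction v)
    case (Suc v)
    have "[b ^ k * (b ^ (k * v) * w) = b ^ k * w] (mod D)"
      using Suc by (rule cong_scalar_left)
    with fixed show ?case
      by (simp add: power_add mult_ac) (metis cong_trans)
  qed auto
  have "[b ^ (k * u) = b ^ 1] (mod D)"
    using u D by (rule power_cong_of_exponent_cong)
  hence "[b ^ (k * u) * w = b * w] (mod D)"
    by (intro cong_scalar_right) simp
  thus ?thesis
    using iter[of u] by (metis cong_sym cong_trans)
qed

lemma dvd_power_pred_imp_dvd_pred: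
  assumes "D dvd N" "\<not> p dvd k" "D dvd b ^ k - 1"
  shows "D dvd b - 1"
  using power_fixes_imp_fixes[of D k 1] assms by (simp add: cong_iff_dvd_diff)

lemma n_dvd_power_pred_iff: "int n dvd b ^ k - 1 \<longleftrightarrow> p dvd k"
proof
  assume dvd: "int n dvd b ^ k - 1"
  show "p dvd k"
  proof (rule ccontr)
    assume "\<not> p dvd k"
    hence "int n dvd b - 1"
      using dvd by (intro dvd_power_pred_imp_dvd_pred) auto
    with coprime_pred_n have "int n dvd 1"
      by (metis coprime_absorb_right dvd_refl)
    thus False using n_ge_2 by simp
  qed
next
  assume "p dvd k"
  hence "[b ^ k = b ^ 0] (mod int n)"
    by (intro power_cong_of_exponent_cong) (auto simp: cong_0_iff)
  thus "int n dvd b ^ k - 1" by (simp add: cong_iff_dvd_diff)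
qed

lemma p_dvd_pred: "int p dvd b - 1"
proof -
  have "int p dvd int (p ^ (m - 1))"
    using m_ge_2 by (simp add: dvd_power)
  thus ?thesis using p_part_dvd_pred by (rule dvd_trans)
qed

lemma gcd_pred_N: "gcd (b - 1) N = int (p ^ (m - 1))"
proof -
  have "gcd (b - 1) N = gcd (b - 1) (int (p ^ m))"
    using gcd_mult_right_left_cancel[of "b - 1" "int n" "int (p ^ m)"] coprime_pred_n by simp
  also have "\<dots> = int (p ^ (m - 1))"
    using p_part_dvd_pred p_part_not_dvd_pred m_ge_2 by (intro gcd_prime_power_eqI prime_p) auto
  finally show ?thesis .
qed

lemma p_power_dvd_square_pred: "int (p ^ m) dvd (b - 1)\<^sup>2"
proof -
  have "p ^ m dvd p ^ (m - 1) * p ^ (m - 1)"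
    using m_ge_2 by (auto simp flip: power_add intro: le_imp_power_dvd)
  hence "int (p ^ m) dvd int (p ^ (m - 1)) * int (p ^ (m - 1))"
    by (simp only: int_dvd_int_iff flip: of_nat_mult)
  also have "\<dots> dvd (b - 1) * (b - 1)"
    by (intro mult_dvd_mono p_part_dvd_pred)
  finally show ?thesis by (simp add: power2_eq_square)
qed

text \<open>
  The binomial expansion of \<open>(1 + (b - 1))\<^sup>k\<close> stops after the linear term, because \<open>(b - 1)\<^sup>2\<close> vanishes
  modulo \<open>p\<^sup>m\<close>.
\<close>

lemma power_linear_cong: "[b ^ k = 1 + int k * (b - 1)] (mod int (p ^ m))"
proof (induction k)
  case (Suc k)
  have "[b * b ^ k = b * (1 + int k * (b - 1))] (mod int (p ^ m))"
    using Suc by (rule cong_scalar_left)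
  moreover have "b * (1 + int k * (b - 1)) - (1 + int (Suc k) * (b - 1)) = int k * (b - 1)\<^sup>2"
    by (simp add: algebra_simps power2_eq_square)
  hence "[b * (1 + int k * (b - 1)) = 1 + int (Suc k) * (b - 1)] (mod int (p ^ m))"
    unfolding cong_iff_dvd_diff using p_power_dvd_square_pred by simp
  ultimately show ?case by (simp only: power_Suc) (rule cong_trans)
qed simp

text \<open>
  The sum is \<open>p + (b - 1) p (p - 1) / 2\<close> up to multiples of \<open>p\<^sup>m\<close>. The second term vanishes modulo \<open>p\<^sup>2\<close> for odd
  \<open>p\<close> since \<open>p\<close> divides both \<open>b - 1\<close> and \<open>p (p - 1) / 2\<close>, and for \<open>p = 2\<close> since \<open>m \<ge> 3\<close> makes \<open>b - 1\<close> divisible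
  by \<open>4\<close>.
\<close>

lemma geometric_sum_p_cong: "[(\<Sum>i<p. b ^ i) = int p] (mod int p ^ 2)"
proof -
  have "int p ^ 2 dvd int (p ^ m)"
    using m_ge_2 by (simp add: le_imp_power_dvd)
  hence "[b ^ i = 1 + int i * (b - 1)] (mod int p ^ 2)" for i
    using power_linear_cong by (rule cong_dvd_modulus[rotated])
  hence "[(\<Sum>i<p. b ^ i) = (\<Sum>i<p. 1 + int i * (b - 1))] (mod int p ^ 2)"
    by (intro cong_sum)
  also have "(\<Sum>i<p. 1 + int i * (b - 1)) = int p + (\<Sum>i<p. int i) * (b - 1)"
    by (simp add: sum.distrib sum_distrib_right)
  also have "[\<dots> = int p + 0] (mod int p ^ 2)"
  proof (intro cong_add cong_refl)
    have "int p ^ 2 dvd (\<Sum>i<p. int i) * (b - 1)"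
    proof (cases "p = 2")
      case True
      hence "int p ^ 2 dvd int (p ^ (m - 1))"
        using m_ge_3[OF True] le_imp_power_dvd[of 2 "m - 1" "int p"] by simp
      thus ?thesis using p_part_dvd_pred by (metis dvd_mult dvd_trans)
    next
      case False
      hence "odd p" using prime_odd_nat[OF prime_p] p_ge_2 by simp
      then obtain h where h: "p = 2 * h + 1" by (elim oddE)
      have "2 * (\<Sum>i<k. int i) = int k * (int k - 1)" for k
        by (induction k) (auto simp: algebra_simps)
      from this[of p] have "(\<Sum>i<p. int i) = int p * int h"
        unfolding h by (simp add: algebra_simps)
      thus ?thesis using p_dvd_pred by (simp add: power2_eq_square mult_dvd_mono)
    qed
    thus "[(\<Sum>i<p. int i) * (b - 1) = 0] (mod int p ^ 2)"
      by (simp add: cong_0_iff)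
  qed
  finally show ?thesis by simp
qed

text \<open>
  If \<open>S\<close> is the geometric sum, then \<open>(x\<^sup>t z)\<^sup>p = x\<^bsup>tS\<^esup>\<close>. The sum contains \<open>p\<close> exactly once, so if this power is
  trivial, then \<open>t\<close> is divisible by \<open>p\<^bsup>m-1\<^esup>\<close>.
\<close>

lemma p_part_dvd_if_dvd_mult_geometric_sum:
  assumes "N dvd t * (\<Sum>i<p. b ^ i)"
  shows "int (p ^ (m - 1)) dvd t"
proof -
  have sq: "int p ^ 2 dvd (\<Sum>i<p. b ^ i) - int p"
    using geometric_sum_p_cong by (simp add: cong_iff_dvd_diff)
  then obtain c where "(\<Sum>i<p. b ^ i) - int p = int p ^ 2 * c" by (elim dvdE)
  hence sum: "(\<Sum>i<p. b ^ i) = int p * (c * int p + 1)"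
    by (simp add: power2_eq_square algebra_simps)
  have "int p * int (p ^ (m - 1)) dvd int p * (t * (c * int p + 1))"
  proof -
    have "int p * int (p ^ (m - 1)) = int (p ^ m)"
      using m_ge_2 by (cases m) auto
    also have "\<dots> dvd N" by simp
    finally show ?thesis using assms unfolding sum by (metis dvd_trans mult.left_commute)
  qed
  hence "int (p ^ (m - 1)) dvd t * (c * int p + 1)"
    using p_pos by simp
  moreover have "gcd (int p) (c * int p + 1) = 1"
    by (simp only: gcd_add_mult) simp
  hence "coprime (int (p ^ (m - 1))) (c * int p + 1)"
    by (simp add: coprime_iff_gcd_eq_1[symmetric] del: coprime_iff_gcd_eq_1)
  ultimately show ?thesis
    by (simp add: coprime_dvd_mult_left_iff)
qed

section \<open>Orbits of multiplication by a unit\<close>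

text \<open>
  The orbit of \<open>w\<close> in the residues modulo \<open>D\<close> under multiplication by \<open>b\<close>, as a union of
  residue classes.
\<close>

definition orb :: "int \<Rightarrow> int \<Rightarrow> int set" where
  "orb D w = {v. \<exists>k. [v = b ^ k * w] (mod D)}"

text \<open>
  One power of \<open>b\<close> suffices on the right because \<open>b\<^bsup>(p-1)k\<^esup>\<close> inverts \<open>b\<^sup>k\<close>.
\<close>

lemma orb_eq_iff:
  assumes D: "D dvd N"
  shows "orb D w = orb D w' \<longleftrightarrow> (\<exists>k. [w = b ^ k * w'] (mod D))"
proof
  assume "orb D w = orb D w'"
  moreover have "w \<in> orb D w"
    unfolding orb_def by (auto intro!: exI[of _ 0])
  ultimately show "\<exists>k. [w = b ^ k * w'] (mod D)"
    unfolding orb_def by auto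
next
  have sub: "orb D u \<subseteq> orb D u'" if "[u = b ^ k * u'] (mod D)" for k u u'
  proof
    fix v assume "v \<in> orb D u"
    then obtain l where "[v = b ^ l * u] (mod D)"
      by (auto simp: orb_def)
    also have "[b ^ l * u = b ^ l * (b ^ k * u')] (mod D)"
      using that by (rule cong_scalar_left)
    finally have "[v = b ^ (l + k) * u'] (mod D)"
      by (simp add: power_add mult_ac)
    thus "v \<in> orb D u'" by (auto simp: orb_def)
  qed
  assume "\<exists>k. [w = b ^ k * w'] (mod D)"
  then obtain k where k: "[w = b ^ k * w'] (mod D)" by blast
  have "p * k = (p - 1) * k + k"
    using p_pos by (cases p) auto
  hence "[b ^ ((p - 1) * k) * b ^ k = b ^ 0] (mod D)"
    unfolding power_add[symmetric]
    using D by (intro power_cong_of_exponent_cong) (simp_all add: cong_0_iff, metis dvd_triv_left)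
  hence "[b ^ ((p - 1) * k) * b ^ k * w' = b ^ 0 * w'] (mod D)"
    by (rule cong_scalar_right)
  moreover have "[b ^ ((p - 1) * k) * w = b ^ ((p - 1) * k) * (b ^ k * w')] (mod D)"
    using k by (rule cong_scalar_left)
  ultimately have "[w' = b ^ ((p - 1) * k) * w] (mod D)"
    by (simp add: mult.assoc) (metis cong_sym cong_trans)
  with k sub show "orb D w = orb D w'" by blast
qed

lemma range_orb:
  assumes "D dvd N" "D > 0"
  shows "range (orb D) = orb D ` {0..<D}"
proof -
  have "orb D w = orb D (w mod D)" for w
    unfolding orb_eq_iff[OF assms(1)] by (auto intro!: exI[of _ 0] simp: cong_def)
  moreover have "w mod D \<in> {0..<D}" for w using assms(2) by simp
  ultimately show ?thesis by blast
qed

lemma fixed_power: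
  assumes "[b * w = w] (mod D)"
  shows "[b ^ k * w = w] (mod D)"
proof (induction k)
  case (Suc k)
  have "[b * (b ^ k * w) = b * w] (mod D)"
    using Suc by (rule cong_scalar_left)
  with assms show ?case by (simp add: mult.assoc) (metis cong_trans)
qed auto

text \<open>
  Orbits have one element (fixed points) or \<open>p\<close> elements. Giving weight \<open>p\<close> to fixed points and weight
  \<open>1\<close> to all other residues makes every orbit weigh \<open>p\<close>; the right-hand side is the total weight.
\<close>

lemma card_orbits:
  assumes D: "D dvd N" "D > 0"
  shows "int p * int (card (range (orb D))) = D + (int p - 1) * gcd (b - 1) D"
proof -
  define fixed where "fixed = (\<lambda>w. [b * w = w] (mod D))"
  define weight where "weight = (\<lambda>w. if fixed w then int p else 1)"
  have fiber: "(\<Sum>w | w \<in> {0..<D} \<and> orb D w = orb D v. weight w) = int p" if v: "v \<in> {0..<D}" for v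
  proof (cases "fixed v")
    case True
    have "{w. w \<in> {0..<D} \<and> orb D w = orb D v} = {v}"
    proof -
      have "w = v" if "w \<in> {0..<D}" "orb D w = orb D v" for w
      proof -
        from that(2) obtain k where "[w = b ^ k * v] (mod D)"
          unfolding orb_eq_iff[OF D(1)] by blast
        with fixed_power[of v D k] True have "[w = v] (mod D)"
          unfolding fixed_def by (metis cong_trans)
        thus "w = v" using that(1) v by (simp add: cong_def)
      qed
      thus ?thesis using v by blast
    qed
    thus ?thesis using True by (simp add: weight_def)
  next
    case False
    \<comment> \<open>By \<open>power_fixes_imp_fixes\<close>, two equal points \<open>b\<^sup>k v\<close> with \<open>k < p\<close> would make \<open>v\<close> a fixed point.\<close>
    have "bij_betw (\<lambda>k. (b ^ k * v) mod D) {..<p} {w. w \<in> {0..<D} \<and> orb D w = orb D v}"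
      unfolding bij_betw_def
    proof
      have "\<not> [b ^ k * v = b ^ l * v] (mod D)" if "k < l" "l < p" for k l
      proof
        assume "[b ^ k * v = b ^ l * v] (mod D)"
        moreover have "b ^ l * v = b ^ k * (b ^ (l - k) * v)"
          using that by (simp flip: power_add mult.assoc)
        ultimately have "[b ^ k * (b ^ (l - k) * v) = b ^ k * v] (mod D)"
          by (simp add: cong_sym_eq)
        moreover have "coprime (b ^ k) D"
          using coprime_b[OF D(1)] by simp
        ultimately have "[b ^ (l - k) * v = v] (mod D)"
          by (simp add: cong_mult_lcancel)
        moreover have "\<not> p dvd l - k"
          using that by (auto dest: dvd_imp_le)
        ultimately show False
          using power_fixes_imp_fixes[OF D(1)] False unfolding fixed_def by blast
      qed
      thus "inj_on (\<lambda>k. (b ^ k * v) mod D) {..<p}"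
        by (intro linorder_inj_onI) (auto simp: cong_def)
      show "(\<lambda>k. (b ^ k * v) mod D) ` {..<p} = {w. w \<in> {0..<D} \<and> orb D w = orb D v}"
      proof (intro equalityI subsetI)
        fix w assume "w \<in> (\<lambda>k. (b ^ k * v) mod D) ` {..<p}"
        then obtain k where "w = (b ^ k * v) mod D" by blast
        thus "w \<in> {w. w \<in> {0..<D} \<and> orb D w = orb D v}"
          using D(2) unfolding orb_eq_iff[OF D(1)] by (auto intro!: exI[of _ k] simp: cong_def)
      next
        fix w assume w: "w \<in> {w. w \<in> {0..<D} \<and> orb D w = orb D v}"
        then obtain k where k: "[w = b ^ k * v] (mod D)"
          unfolding orb_eq_iff[OF D(1)] by blast
        have "[b ^ k * v = b ^ (k mod p) * v] (mod D)"
          using D(1) by (intro cong_scalar_right power_cong_of_exponent_cong) (auto simp: cong_def)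
        with k have "w mod D = (b ^ (k mod p) * v) mod D"
          by (simp add: cong_def)
        moreover have "w mod D = w" using w by auto
        ultimately show "w \<in> (\<lambda>k. (b ^ k * v) mod D) ` {..<p}"
          using p_pos by (auto intro!: image_eqI[of _ _ "k mod p"])
      qed
    qed
    from bij_betw_same_card[OF this]
    have "card {w. w \<in> {0..<D} \<and> orb D w = orb D v} = p" by simp
    moreover have "weight w = 1" if "w \<in> {w. w \<in> {0..<D} \<and> orb D w = orb D v}" for w
    proof -
      have "\<not> fixed w"
      proof
        assume w: "fixed w"
        from that obtain k where "[v = b ^ k * w] (mod D)"
          using orb_eq_iff[OF D(1), of v w] by auto
        with fixed_power[of w D k] w have vw: "[v = w] (mod D)"
          unfolding fixed_def by (metis cong_trans)
        hence "[b * v = b * w] (mod D)" by (rule cong_scalar_left)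
        with vw w False show False
          unfolding fixed_def by (metis cong_sym cong_trans)
      qed
      thus ?thesis by (simp add: weight_def)
    qed
    ultimately show ?thesis by simp
  qed
  have "int p * int (card (range (orb D))) = (\<Sum>Z\<in>orb D ` {0..<D}. int p)"
    by (simp add: range_orb[OF D])
  also have "\<dots> = (\<Sum>Z\<in>orb D ` {0..<D}. \<Sum>w | w \<in> {0..<D} \<and> orb D w = Z. weight w)"
    using fiber by (intro sum.cong) auto
  also have "\<dots> = (\<Sum>w\<in>{0..<D}. weight w)"
    by (rule sum.image_gen[symmetric]) simp
  also have "\<dots> = (\<Sum>w\<in>{0..<D}. 1 + (if fixed w then int p - 1 else 0))"
    by (intro sum.cong) (auto simp: weight_def)
  also have "\<dots> = D + (int p - 1) * int (card {w \<in> {0..<D}. fixed w})"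
    using D(2) by (simp add: sum.distrib sum.If_cases Int_def mult.commute)
  also have "{w \<in> {0..<D}. fixed w} = {w \<in> {0..<D}. D dvd (b - 1) * w}"
    by (auto simp: fixed_def cong_iff_dvd_diff algebra_simps)
  finally show ?thesis
    using card_annihilated_residues[OF D(2), of "b - 1"] by simp
qed

section \<open>The tuple attached to a unit\<close>

text \<open>
  For the automorphism that raises \<open>C\<^sub>N\<close> to the power \<open>s\<close>, the twisted classes in the coset of \<open>C\<^sub>N\<close> with
  index \<open>j\<close> are the orbits of \<open>b\<close> on the residues modulo this number.
\<close>

definition modulus :: "int \<Rightarrow> nat \<Rightarrow> int" where
  "modulus s j = gcd (1 - s * b ^ j) N"

text \<open>
  This number turns out to divide all moduli; it is the number \<open>p\<^sup>e\<close> of the final formula.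
\<close>

definition common :: "int \<Rightarrow> int" where
  "common s = gcd (1 - s) (int (p ^ (m - 1)))"

lemma modulus_dvd_N: "modulus s j dvd N"
  unfolding modulus_def by (rule gcd_dvd2)

lemma modulus_pos: "modulus s j > 0"
  using N_pos gcd_pos_int[of "1 - s * b ^ j" N] unfolding modulus_def by linarith

lemma modulus_cong:
  assumes "[j = j'] (mod p)"
  shows "modulus s j = modulus s j'"
  unfolding modulus_def
  using power_cong_of_exponent_cong[OF assms dvd_refl]
  by (intro cong_gcd_eq cong_diff cong_refl cong_scalar_left)

lemma cong_1_p_part: "[1 - s * b ^ j = 1 - s] (mod int (p ^ (m - 1)))"
proof -
  have "[b = 1] (mod int (p ^ (m - 1)))"
    using p_part_dvd_pred by (simp add: cong_iff_dvd_diff)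
  hence "[1 - s * b ^ j = 1 - s * 1 ^ j] (mod int (p ^ (m - 1)))"
    by (intro cong_diff cong_refl cong_scalar_left cong_pow)
  thus ?thesis by simp
qed

text \<open>
  The number of fixed points of \<open>b\<close> modulo \<open>modulus s j\<close> does not depend on \<open>j\<close>: the only common part of
  \<open>b - 1\<close> and \<open>N\<close> is \<open>p\<^bsup>m-1\<^esup>\<close>, and modulo this \<open>b\<close> is \<open>1\<close>.
\<close>

lemma gcd_pred_modulus: "gcd (b - 1) (modulus s j) = common s"
proof -
  have "gcd (b - 1) (modulus s j) = gcd (1 - s * b ^ j) (gcd (b - 1) N)"
    by (simp add: modulus_def gcd.left_commute)
  also have "\<dots> = gcd (1 - s) (int (p ^ (m - 1)))"
    unfolding gcd_pred_N using cong_1_p_part by (rule cong_gcd_eq)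
  finally show ?thesis by (simp add: common_def)
qed

text \<open>
  If \<open>s\<close> is \<open>1\<close> modulo \<open>p\<^bsup>m-1\<^esup>\<close>, then modulo \<open>p\<^sup>m\<close> it lies in the group of order \<open>p\<close> generated by \<open>b\<close>. Writing
  \<open>1 - s = p\<^bsup>m-1\<^esup> \<sigma>\<close> and \<open>b - 1 = p\<^bsup>m-1\<^esup> \<tau>\<close>, the exponent \<open>j\<close> is the solution of the linear congruence
  \<open>\<tau> j = \<sigma>\<close> modulo \<open>p\<close>.
\<close>

lemma ex_modulus_p_power_dvd:
  assumes "int (p ^ (m - 1)) dvd 1 - s"
  shows "\<exists>j<p. int (p ^ m) dvd 1 - s * b ^ j"
proof -
  define q where "q = int (p ^ (m - 1))"
  obtain \<sigma> where \<sigma>: "1 - s = q * \<sigma>" using assms unfolding q_def by (elim dvdE)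
  obtain \<tau> where \<tau>: "b - 1 = q * \<tau>" using p_part_dvd_pred unfolding q_def by (elim dvdE)
  have pm: "int (p ^ m) = q * int p"
    using m_ge_2 by (cases m) (auto simp: q_def mult.commute)
  have "\<not> int p dvd \<tau>"
    using p_part_not_dvd_pred unfolding pm \<tau> by (auto intro: mult_dvd_mono)
  hence "coprime \<tau> (int p)"
    using prime_p by (metis coprime_commute prime_imp_coprime prime_nat_int_transfer)
  then obtain \<rho> where \<rho>: "[\<tau> * \<rho> = 1] (mod int p)"
    using cong_solve_coprime_int by blast
  define j where "j = nat ((\<rho> * \<sigma>) mod int p)"
  have j: "int j = (\<rho> * \<sigma>) mod int p"
    using p_pos by (simp add: j_def)
  have "[\<tau> * int j = \<tau> * (\<rho> * \<sigma>)] (mod int p)"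
    unfolding j by (intro cong_scalar_left) simp
  also have "[\<tau> * (\<rho> * \<sigma>) = 1 * \<sigma>] (mod int p)"
    using cong_scalar_right[OF \<rho>, of \<sigma>] by (simp add: mult.assoc)
  finally have "int p dvd \<sigma> - int j * \<tau>"
    by (simp add: cong_iff_dvd_diff mult.commute dvd_diff_commute)
  hence "int (p ^ m) dvd q * (\<sigma> - int j * \<tau>)"
    unfolding pm by (intro mult_dvd_mono) auto
  moreover have "q * (\<sigma> - int j * \<tau>) = (1 - s * (1 + int j * (b - 1))) - int j * (1 - s) * (b - 1)"
    by (simp only: \<sigma>[symmetric] \<tau>[symmetric] right_diff_distrib mult.left_commute[of q]) (simp add: algebra_simps)
  moreover have "int (p ^ m) dvd int j * (1 - s) * (b - 1)"
  proof -
    have "int (p ^ m) dvd q * q"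
      using m_ge_2 unfolding q_def
      by (auto simp flip: of_nat_mult power_add simp: int_dvd_int_iff simp del: of_nat_power intro: le_imp_power_dvd)
    thus ?thesis unfolding \<sigma> \<tau>
      by (metis dvd_mult dvd_mult2 mult.assoc mult.left_commute)
  qed
  ultimately have "int (p ^ m) dvd 1 - s * (1 + int j * (b - 1))"
    by (metis diff_add_cancel dvd_add)
  moreover have "[1 - s * b ^ j = 1 - s * (1 + int j * (b - 1))] (mod int (p ^ m))"
    using power_linear_cong by (intro cong_diff cong_refl cong_scalar_left)
  ultimately have "int (p ^ m) dvd 1 - s * b ^ j"
    by (simp add: cong_dvd_iff)
  moreover have "j < p"
    using p_pos by (simp add: j_def nat_less_iff)
  ultimately show ?thesis by blast
qed

text \<open>
  The index set of the spectrum for all primes at once. The two extra conditions for \<open>p = 2\<close> have the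
  same origin, a shortage of units: a unit modulo \<open>2\<^sup>m\<close> is odd, hence \<open>1\<close> modulo \<open>2\<close>, and every unit
  modulo \<open>3\<close> is a power of \<open>b\<close>.
\<close>

definition admissible :: "nat \<Rightarrow> nat list \<Rightarrow> bool" where
  "admissible e d \<longleftrightarrow> e \<le> m - 1 \<and> (p = 2 \<longrightarrow> 1 \<le> e) \<and>
     d \<in> coprime_divisor_tuples (n * p) p \<and> ((\<exists>j<p. p dvd d ! j) \<longleftrightarrow> e = m - 1) \<and>
     (p = 2 \<and> 3 dvd n \<longrightarrow> (\<exists>j<p. 3 dvd d ! j))"

lemma admissible_coprime:
  assumes "admissible e d" "i < p" "j < p" "i \<noteq> j"
  shows "coprime (d ! i) (d ! j)"
  using assms unfolding admissible_def coprime_divisor_tuples_def coprime_iff_gcd_eq_1 by blast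

text \<open>
  Translates the uniform index set into the case distinction of the spectrum formulas.
\<close>

lemma admissible_iff:
  "admissible e d \<longleftrightarrow> e \<le> m - 1 \<and> (p = 2 \<longrightarrow> 1 \<le> e) \<and>
     d \<in> (if p = 2 \<and> [n = 0] (mod 3) then coprime_divisor_tuples3 (n * p) p else coprime_divisor_tuples (n * p) p) \<and>
     ([prod_list d = 0] (mod p) \<longleftrightarrow> e = m - 1)"
proof (cases "d \<in> coprime_divisor_tuples (n * p) p")
  case True
  hence "length d = p" by (simp add: coprime_divisor_tuples_def)
  thus ?thesis using True
    by (auto simp: admissible_def coprime_divisor_tuples3_def cong_0_iff prime_dvd_prod_list_iff[OF prime_p])
qed (auto simp: admissible_def coprime_divisor_tuples3_def)

definition realises :: "int \<Rightarrow> nat \<Rightarrow> nat list \<Rightarrow> bool" where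
  "realises s e d \<longleftrightarrow> common s = int (p ^ e) \<and> (\<forall>j<p. modulus s j = int (p ^ e) * int (d ! j))"

text \<open>
  A common divisor of the moduli at \<open>i\<close> and \<open>j\<close> divides \<open>s b\<^sup>i (b\<^bsup>j-i\<^esup> - 1)\<close>, hence \<open>b\<^bsup>j-i\<^esup> - 1\<close>, hence \<open>b - 1\<close>. So it
  lies in the common part, and the quotients by the common part are pairwise coprime.
\<close>

lemma gcd_moduli:
  assumes s: "coprime s N" and ij: "i < j" "j < p"
  shows "gcd (modulus s i) (modulus s j) dvd common s"
proof -
  define g where "g = gcd (modulus s i) (modulus s j)"
  have g_N: "g dvd N"
    unfolding g_def using modulus_dvd_N by (meson dvd_trans gcd_dvd1)
  have "g dvd 1 - s * b ^ i" "g dvd 1 - s * b ^ j"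
    unfolding g_def modulus_def by (meson dvd_trans gcd_dvd1 gcd_dvd2)+
  hence "g dvd (1 - s * b ^ i) - (1 - s * b ^ j)" by (rule dvd_diff)
  also have "\<dots> = s * b ^ i * (b ^ (j - i) - 1)"
    using ij by (simp add: algebra_simps flip: power_add)
  finally have "g dvd b ^ (j - i) - 1"
  proof -
    assume dvd: "g dvd s * b ^ i * (b ^ (j - i) - 1)"
    have "coprime s g"
      using s g_N coprime_divisors dvd_refl by blast
    hence "coprime g (s * b ^ i)"
      using coprime_b[OF g_N] by (simp add: coprime_commute)
    thus ?thesis using dvd by (simp add: coprime_dvd_mult_right_iff)
  qed
  moreover have "\<not> p dvd j - i"
    using ij by (auto dest: dvd_imp_le)
  ultimately have "g dvd b - 1"
    using dvd_power_pred_imp_dvd_pred[OF g_N] by blast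
  moreover have "g dvd modulus s i" by (simp add: g_def)
  ultimately show ?thesis
    unfolding gcd_pred_modulus[of s i, symmetric] g_def by (rule gcd_greatest)
qed

text \<open>
  The tuple consists of the moduli divided by their common part \<open>p\<^sup>e\<close>. If \<open>e < m - 1\<close>, a further factor \<open>p\<close> in
  some modulus would also divide \<open>b - 1\<close> and thus the common part; if \<open>e = m - 1\<close>, the lemma
  \<open>ex_modulus_p_power_dvd\<close> provides the entry divisible by \<open>p\<close>.
\<close>

lemma unit_realises_admissible:
  assumes s: "coprime s N"
  shows "\<exists>e d. admissible e d \<and> realises s e d"
proof -
  obtain e where e: "e \<le> m - 1" and common: "common s = int (p ^ e)"
    unfolding common_def using gcd_prime_power_obtain[OF prime_p] .
  define d where "d = map (\<lambda>j. nat (modulus s j div int (p ^ e))) [0..<p]"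
  have pe_pos: "int (p ^ e) > 0" using p_pos by simp
  have modulus_d: "modulus s j = int (p ^ e) * int (d ! j)" if "j < p" for j
  proof -
    have "int (p ^ e) dvd modulus s j"
      using gcd_pred_modulus[of s j] common by (metis gcd_dvd2)
    moreover have "modulus s j div int (p ^ e) \<ge> 0"
      using modulus_pos[of s j] pe_pos by (simp add: pos_imp_zdiv_nonneg_iff)
    ultimately show ?thesis using that by (simp add: d_def)
  qed
  have p_dvd_iff: "p dvd d ! j \<longleftrightarrow> int (p ^ (e + 1)) dvd modulus s j" if "j < p" for j
  proof -
    have "int (p ^ (e + 1)) dvd modulus s j \<longleftrightarrow> int (p ^ e) * int p dvd int (p ^ e) * int (d ! j)"
      unfolding modulus_d[OF that] by (simp add: mult.commute)
    also have "\<dots> \<longleftrightarrow> p dvd d ! j"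
      using pe_pos by (subst dvd_mult_cancel_left) auto
    finally show ?thesis ..
  qed
  have not_p_dvd: "\<not> p dvd d ! j" if "j < p" "e < m - 1" for j
  proof
    assume "p dvd d ! j"
    hence "int (p ^ (e + 1)) dvd modulus s j"
      using p_dvd_iff that by blast
    moreover have "int (p ^ (e + 1)) dvd b - 1"
    proof -
      have "int (p ^ (e + 1)) dvd int (p ^ (m - 1))"
        using le_imp_power_dvd[of "e + 1" "m - 1" p] that by (simp only: int_dvd_int_iff)
      thus ?thesis using p_part_dvd_pred by (rule dvd_trans)
    qed
    ultimately have "int (p ^ (e + 1)) dvd int (p ^ e)"
      unfolding common[symmetric] gcd_pred_modulus[of s j, symmetric] by (metis gcd_greatest)
    hence "p ^ (e + 1) dvd p ^ e" by (simp only: int_dvd_int_iff)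
    thus False using p_ge_2 by (simp add: dvd_power_iff_le)
  qed
  have dvd: "d ! j dvd n * p" if "j < p" for j
  proof -
    have "p ^ e * d ! j dvd n * p ^ m"
      using modulus_dvd_N[of s j] unfolding modulus_d[OF that]
      by (simp only: int_dvd_int_iff flip: of_nat_mult)
    show ?thesis
    proof (cases "e = m - 1")
      case True
      hence "n * p ^ m = p ^ e * (n * p)"
        using m_ge_2 by (cases m) auto
      with \<open>p ^ e * d ! j dvd n * p ^ m\<close> show ?thesis
        using p_pos by simp
    next
      case False
      hence "\<not> p dvd d ! j" using not_p_dvd that e by simp
      hence "coprime (d ! j) (p ^ m)"
        using prime_p by (metis coprime_commute coprime_power_right_iff prime_imp_coprime_nat)
      moreover have "d ! j dvd n * p ^ m"
        using \<open>p ^ e * d ! j dvd n * p ^ m\<close> by (rule dvd_mult_right)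
      ultimately have "d ! j dvd n"
        by (simp add: coprime_dvd_mult_left_iff)
      thus ?thesis by simp
    qed
  qed
  have coprime_lt: "gcd (d ! i) (d ! j) = 1" if ij: "i < j" "j < p" for i j
  proof -
    have "gcd (modulus s i) (modulus s j) = int (p ^ e * gcd (d ! i) (d ! j))"
      using ij by (simp add: modulus_d gcd_mult_distrib_nat flip: of_nat_mult of_nat_power)
    with gcd_moduli[OF s ij] common have "p ^ e * gcd (d ! i) (d ! j) dvd p ^ e * 1"
      by (simp only: int_dvd_int_iff mult_1_right)
    thus ?thesis using p_pos by (simp only: nat_mult_dvd_cancel_disj) simp
  qed
  have "gcd (d ! i) (d ! j) = 1" if "i < p" "j < p" "i \<noteq> j" for i j
    using coprime_lt[of i j] coprime_lt[of j i] that by (metis gcd.commute linorder_neqE_nat)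
  hence "d \<in> coprime_divisor_tuples (n * p) p"
    using dvd by (simp add: coprime_divisor_tuples_def) (simp add: d_def)
  moreover have "(\<exists>j<p. p dvd d ! j) \<longleftrightarrow> e = m - 1"
  proof
    assume "\<exists>j<p. p dvd d ! j"
    thus "e = m - 1" using not_p_dvd e by (metis le_neq_implies_less)
  next
    assume e': "e = m - 1"
    hence "int (p ^ (m - 1)) dvd 1 - s"
      using common unfolding common_def by (metis gcd_dvd1)
    then obtain j where j: "j < p" "int (p ^ m) dvd 1 - s * b ^ j"
      using ex_modulus_p_power_dvd by blast
    have "int (p ^ m) dvd N" by simp
    with j(2) have "int (p ^ m) dvd modulus s j"
      unfolding modulus_def by (rule gcd_greatest)
    moreover have "e + 1 = m" using e' m_ge_2 by simp
    ultimately show "\<exists>j<p. p dvd d ! j"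
      using p_dvd_iff j(1) by metis
  qed
  moreover have "1 \<le> e" if "p = 2"
  proof -
    have "even N" using that m_ge_2 by simp
    hence "odd s" using s coprime_common_divisor[of s N 2] by auto
    hence "2 dvd 1 - s" by simp
    moreover have "(2::int) dvd int (p ^ (m - 1))" using that m_ge_2 by simp
    ultimately have "2 dvd common s" unfolding common_def by (rule gcd_greatest)
    thus "1 \<le> e" using common by (cases e) auto
  qed
  moreover have "\<exists>j<p. 3 dvd d ! j" if p2: "p = 2" and "3 dvd n"
  proof -
    have "int 3 dvd int n" using \<open>3 dvd n\<close> by (simp only: int_dvd_int_iff)
    hence n3: "3 dvd int n" and N3: "3 dvd N" by auto
    have no3: "\<not> 3 dvd t" if "coprime t w" "3 dvd w" for t w :: int
      using that coprime_common_divisor[of t w 3] by auto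
    \<comment> \<open>Modulo \<open>3\<close> the integer \<open>b\<close> is neither \<open>0\<close> nor \<open>1\<close>, so the unit \<open>s\<close> is \<open>b\<^sup>0\<close> or \<open>b\<^sup>1\<close>.\<close>
    have "b mod 3 = 2"
      using no3[OF coprime_pred_n n3] no3[OF coprime_b[OF dvd_refl] N3] by presburger
    moreover have "s mod 3 = 1 \<or> s mod 3 = 2"
      using no3[OF s N3] by presburger
    moreover have "3 dvd 1 - s" if "s mod 3 = 1"
      using that by presburger
    moreover have "[s * b = 2 * 2] (mod 3)" if "s mod 3 = 2" "b mod 3 = 2"
      using that by (intro cong_mult) (simp_all add: cong_def)
    ultimately have "3 dvd 1 - s \<or> [s * b = 2 * 2] (mod 3)"
      by blast
    moreover have "3 dvd 1 - s * b" if "[s * b = 2 * 2] (mod 3)"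
      using that unfolding cong_def by presburger
    ultimately have "3 dvd 1 - s * b ^ 0 \<or> 3 dvd 1 - s * b ^ 1"
      by auto
    then obtain j where j: "j < p" "3 dvd 1 - s * b ^ j"
      using that[of 0] that[of 1] p2 by auto
    hence "3 dvd modulus s j"
      unfolding modulus_def using N3 by (intro gcd_greatest)
    hence "3 dvd 2 ^ e * int (d ! j)" using modulus_d[OF j(1)] p2 by simp
    moreover have "coprime (3::int) (2 ^ e)" by simp
    ultimately have "int 3 dvd int (d ! j)"
      by (simp add: coprime_dvd_mult_right_iff)
    thus ?thesis using j(1) by (auto simp only: int_dvd_int_iff)
  qed
  ultimately have "admissible e d"
    using e by (simp add: admissible_def)
  moreover have "realises s e d"
    using common modulus_d by (simp add: realises_def)
  ultimately show ?thesis by blast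
qed

section \<open>Units with a prescribed tuple\<close>

lemma not_dvd_diff_add:
  assumes "i < p" "j < p" "j \<noteq> i"
  shows "\<not> p dvd p - i + j"
proof
  assume "p dvd p - i + j"
  then obtain c where c: "p - i + j = p * c" by (elim dvdE)
  hence "0 < p * c" "p * c < p * 2" "p * c \<noteq> p * 1"
    using assms by linarith+
  hence "0 < c" "c < 2" "c \<noteq> 1" by auto
  thus False by linarith
qed

text \<open>
  At most one \<open>\<delta> j\<close> is divisible by \<open>q\<close>. If \<open>\<delta> j\<^sub>0\<close> is, then \<open>s = b\<^bsup>-j\<^sub>0\<^esup> (1 - \<delta> j\<^sub>0)\<close> is a unit
  with \<open>1 - s b\<^sup>j = \<delta> j\<close> at \<open>j = j\<^sub>0\<close>, and \<open>q\<close> divides no other \<open>1 - s b\<^sup>j\<close>. If none is, the unit has to avoid all powers of \<open>b\<close> modulo \<open>q\<close>; there are \<open>p\<close> of them, which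
  exhausts the \<open>q - 1\<close> units only if \<open>q = p + 1\<close>, that is \<open>p = 2\<close> and \<open>q = 3\<close>.
\<close>

lemma ex_unit_prime_power:
  fixes \<delta> :: "nat \<Rightarrow> nat"
  assumes q: "Factorial_Ring.prime q" "q ^ f dvd n" "f > 0"
    and cop: "\<And>i j. i < p \<Longrightarrow> j < p \<Longrightarrow> i \<noteq> j \<Longrightarrow> coprime (\<delta> i) (\<delta> j)"
    and three: "p = 2 \<Longrightarrow> q = 3 \<Longrightarrow> \<exists>j<p. 3 dvd \<delta> j"
  shows "\<exists>s. coprime s (int q) \<and> (\<forall>j<p. gcd (1 - s * b ^ j) (int (q ^ f)) = gcd (int (\<delta> j)) (int (q ^ f)))"
proof -
  have "q dvd q ^ f" using q(3) by simp
  hence "q dvd n" using q(2) by (rule dvd_trans)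
  hence qn: "int q dvd int n" by (simp only: int_dvd_int_iff)
  hence qN: "int q dvd N" by simp
  have qfN: "int (q ^ f) dvd N"
    using q(2) by (simp only: int_dvd_int_iff) simp
  have q_prime: "Factorial_Ring.prime (int q)" using q(1) by simp
  have coprime_qf: "gcd t (int (q ^ f)) = 1" if "\<not> int q dvd t" for t
  proof -
    have "coprime t (int q)"
      using that q_prime by (metis coprime_commute prime_imp_coprime)
    thus ?thesis by simp
  qed
  have powers_distinct: "\<not> int q dvd b ^ i * (b ^ k - 1)" if "\<not> p dvd k" for i k
  proof
    assume "int q dvd b ^ i * (b ^ k - 1)"
    moreover have "coprime (int q) (b ^ i)"
      using coprime_b[OF qN] by (simp add: coprime_commute)
    ultimately have "int q dvd b ^ k - 1"
      by (simp add: coprime_dvd_mult_right_iff)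
    hence "int q dvd b - 1"
      using dvd_power_pred_imp_dvd_pred[OF qN that] by blast
    hence "is_unit (int q)"
      using coprime_common_divisor[OF coprime_pred_n _ qn] by blast
    thus False using q_prime not_prime_unit by blast
  qed
  show ?thesis
  proof (cases "\<exists>j<p. q dvd \<delta> j")
    case True
    then obtain j0 where j0: "j0 < p" "q dvd \<delta> j0" by blast
    define s where "s = b ^ (p - j0) * (1 - int (\<delta> j0))"
    have q_dvd_\<delta>: "int q dvd int (\<delta> j0)" using j0(2) by (simp only: int_dvd_int_iff)
    have "coprime s (int q)"
    proof -
      have "\<not> int q dvd 1 - int (\<delta> j0)"
      proof
        assume "int q dvd 1 - int (\<delta> j0)"
        hence "int q dvd (1 - int (\<delta> j0)) + int (\<delta> j0)" using q_dvd_\<delta> by (rule dvd_add)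
        thus False using q_prime not_prime_unit by auto
      qed
      hence "coprime (1 - int (\<delta> j0)) (int q)"
        using q_prime by (metis coprime_commute prime_imp_coprime)
      thus ?thesis using coprime_b[OF qN] by (simp add: s_def)
    qed
    moreover have "gcd (1 - s * b ^ j) (int (q ^ f)) = gcd (int (\<delta> j)) (int (q ^ f))" if j: "j < p" for j
    proof (cases "j = j0")
      case True
      have "[b ^ (p - j0) * b ^ j0 = 1] (mod int (q ^ f))"
        using j0(1) power_cong_of_exponent_cong[of p 0, OF _ qfN] by (simp add: cong_0_iff flip: power_add)
      hence "[1 - (b ^ (p - j0) * b ^ j0) * (1 - int (\<delta> j0)) = 1 - 1 * (1 - int (\<delta> j0))] (mod int (q ^ f))"
        by (intro cong_diff cong_refl cong_scalar_right)
      hence "[1 - s * b ^ j = int (\<delta> j)] (mod int (q ^ f))"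
        by (simp add: s_def True mult_ac)
      thus ?thesis by (rule cong_gcd_eq)
    next
      case False
      have "\<not> int q dvd 1 - s * b ^ j"
      proof
        assume "int q dvd 1 - s * b ^ j"
        moreover have "1 - s * b ^ j = (1 - b ^ (p - j0 + j)) + b ^ (p - j0 + j) * int (\<delta> j0)"
          by (simp add: s_def algebra_simps power_add)
        ultimately have "int q dvd 1 - b ^ (p - j0 + j)"
          using q_dvd_\<delta> by (metis dvd_add_left_iff dvd_mult)
        hence "int q dvd b ^ 0 * (b ^ (p - j0 + j) - 1)"
          by (simp add: dvd_diff_commute)
        moreover have "\<not> p dvd p - j0 + j"
          using not_dvd_diff_add[OF j0(1) j False] .
        ultimately show False using powers_distinct by blast
      qed
      moreover have "\<not> int q dvd int (\<delta> j)"
      proof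
        assume "int q dvd int (\<delta> j)"
        hence "q dvd \<delta> j" by (simp only: int_dvd_int_iff)
        with cop[OF j j0(1) False] j0(2) have "is_unit q"
          by (metis coprime_common_divisor)
        thus False using q(1) not_prime_unit by blast
      qed
      ultimately show ?thesis using coprime_qf by metis
    qed
    ultimately show ?thesis by blast
  next
    case False
    have "(\<lambda>j. b ^ j mod int q) ` {..<p} \<noteq> {1..<int q}"
    proof
      assume eq: "(\<lambda>j. b ^ j mod int q) ` {..<p} = {1..<int q}"
      have "inj_on (\<lambda>j. b ^ j mod int q) {..<p}"
      proof (intro linorder_inj_onI)
        fix i j assume ij: "i < j" "i \<in> {..<p}" "j \<in> {..<p}"
        show "b ^ i mod int q \<noteq> b ^ j mod int q"
        proof
          assume "b ^ i mod int q = b ^ j mod int q"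
          hence "int q dvd b ^ j - b ^ i" by (metis mod_eq_dvd_iff)
          also have "b ^ j - b ^ i = b ^ i * (b ^ (j - i) - 1)"
            using ij by (simp add: algebra_simps flip: power_add)
          finally have "int q dvd b ^ i * (b ^ (j - i) - 1)" .
          moreover have "\<not> p dvd j - i" using ij by (auto dest: dvd_imp_le)
          ultimately show False using powers_distinct by blast
        qed
      qed auto
      hence "card {1..<int q} = p"
        unfolding eq[symmetric] by (simp add: card_image)
      hence pq: "q = p + 1" using prime_ge_2_nat[OF q(1)] by simp
      have "p = 2"
      proof (rule ccontr)
        assume "p \<noteq> 2"
        hence "odd p" "odd q"
          using prime_odd_nat[OF prime_p] prime_odd_nat[OF q(1)] p_ge_2 pq by simp_all
        thus False using pq by simp
      qed
      with pq three False show False by auto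
    qed
    moreover have "(\<lambda>j. b ^ j mod int q) ` {..<p} \<subseteq> {1..<int q}"
    proof -
      have "b ^ j mod int q \<noteq> 0" for j
      proof
        assume "b ^ j mod int q = 0"
        hence "int q dvd b ^ j" by (simp add: dvd_eq_mod_eq_0)
        moreover have "coprime (b ^ j) (int q)" using coprime_b[OF qN] by simp
        ultimately have "is_unit (int q)"
          by (metis coprime_common_divisor dvd_refl)
        thus False using q_prime not_prime_unit by blast
      qed
      moreover have "0 \<le> b ^ j mod int q" "b ^ j mod int q < int q" for j
        using prime_gt_0_nat[OF q(1)] by simp_all
      ultimately have "b ^ j mod int q \<in> {1..<int q}" for j
        using order_le_imp_less_or_eq[of 0 "b ^ j mod int q"] by (metis atLeastLessThan_iff int_one_le_iff_zero_less)
      thus ?thesis by blast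
    qed
    ultimately obtain t where t: "t \<in> {1..<int q}" "\<And>j. j < p \<Longrightarrow> t \<noteq> b ^ j mod int q"
      by blast
    have t_unit: "\<not> int q dvd t" using t(1) by (auto dest: zdvd_imp_le)
    hence "coprime t (int q)"
      using q_prime by (metis coprime_commute prime_imp_coprime)
    then obtain s where s: "[t * s = 1] (mod int q)"
      using cong_solve_coprime_int by blast
    have "coprime s (int q)"
      using s by (metis coprime_iff_invertible_int mult.commute)
    moreover have "gcd (1 - s * b ^ j) (int (q ^ f)) = gcd (int (\<delta> j)) (int (q ^ f))" if j: "j < p" for j
    proof -
      have "\<not> int q dvd 1 - s * b ^ j"
      proof
        assume "int q dvd 1 - s * b ^ j"
        hence "[1 = s * b ^ j] (mod int q)" by (simp add: cong_iff_dvd_diff)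
        hence "[t * 1 = t * (s * b ^ j)] (mod int q)" by (rule cong_scalar_left)
        moreover have "[t * s * b ^ j = 1 * b ^ j] (mod int q)"
          using s by (rule cong_scalar_right)
        ultimately have "[t = b ^ j] (mod int q)"
          by (simp add: mult.assoc) (metis cong_trans)
        hence "t = b ^ j mod int q" using t(1) by (simp add: cong_def)
        thus False using t(2) j by blast
      qed
      moreover have "\<not> int q dvd int (\<delta> j)"
        using False j by (simp only: int_dvd_int_iff) blast
      ultimately show ?thesis using coprime_qf by metis
    qed
    ultimately show ?thesis by blast
  qed
qed

lemma gcd_unit_cong:
  assumes "[s = s'] (mod q)"
  shows "gcd (1 - s * b ^ j) q = gcd (1 - s' * b ^ j) q"
  using assms by (intro cong_gcd_eq cong_diff cong_refl cong_scalar_right)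

text \<open>
  The local solutions of \<open>ex_unit_prime_power\<close> are glued together by the Chinese remainder theorem.
  The gcd with \<open>k\<close> on both sides lets the condition pass to divisors of \<open>k\<close>.
\<close>

lemma ex_unit_dvd_n:
  fixes \<delta> :: "nat \<Rightarrow> nat"
  assumes "k dvd n"
    and cop: "\<And>i j. i < p \<Longrightarrow> j < p \<Longrightarrow> i \<noteq> j \<Longrightarrow> coprime (\<delta> i) (\<delta> j)"
    and three: "p = 2 \<Longrightarrow> 3 dvd k \<Longrightarrow> \<exists>j<p. 3 dvd \<delta> j"
  shows "\<exists>s. coprime s (int k) \<and> (\<forall>j<p. gcd (1 - s * b ^ j) (int k) = gcd (int (\<delta> j)) (int k))"
  using assms(1,3)
proof (induction k rule: less_induct)
  case (less k)
  have k_pos: "k > 0" using less.prems(1) n_ge_2 by (auto intro!: Nat.gr0I)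
  show ?case
  proof (cases "k = 1")
    case False
    then obtain q where q: "Factorial_Ring.prime q" "q dvd k"
      using prime_factor_nat by blast
    define f where "f = multiplicity q k"
    obtain r where r: "k = q ^ f * r" "\<not> q dvd r"
      unfolding f_def using multiplicity_decompose'[of k q] k_pos q(1) not_prime_unit by blast
    have "f > 0"
      using r q(2) by (intro Nat.gr0I) auto
    have "r > 0" using r(1) k_pos by (intro Nat.gr0I) auto
    hence "r < k"
      using r(1) \<open>f > 0\<close> prime_gt_1_nat[OF q(1)] using one_less_power[of q f] by simp
    have "q ^ f dvd k" "r dvd k" using r(1) by auto
    then obtain s1 where s1: "coprime s1 (int r)"
        "\<forall>j<p. gcd (1 - s1 * b ^ j) (int r) = gcd (int (\<delta> j)) (int r)"
      using less.IH[OF \<open>r < k\<close>] less.prems by (meson dvd_trans)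
    obtain s2 where s2: "coprime s2 (int q)"
        "\<forall>j<p. gcd (1 - s2 * b ^ j) (int (q ^ f)) = gcd (int (\<delta> j)) (int (q ^ f))"
      using ex_unit_prime_power[of q f \<delta>] q \<open>f > 0\<close> cop less.prems dvd_trans[OF \<open>q ^ f dvd k\<close>] by blast
    have coprime_qr: "coprime (int (q ^ f)) (int r)"
      using r(2) q(1) by (simp add: prime_imp_coprime_nat coprime_int_iff flip: of_nat_power)
    obtain s where s: "[s = s2] (mod int (q ^ f))" "[s = s1] (mod int r)"
      using binary_chinese_remainder_int[OF coprime_qr] by blast
    have "coprime s (int (q ^ f))" "coprime s (int r)"
      using s s1(1) s2(1) cong_imp_coprime[OF cong_sym[OF s(1)]] cong_imp_coprime[OF cong_sym[OF s(2)]]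
      by auto
    hence "coprime s (int k)"
      unfolding r(1) by simp
    moreover have "gcd (1 - s * b ^ j) (int k) = gcd (int (\<delta> j)) (int k)" if "j < p" for j
      unfolding r(1) of_nat_mult
      using coprime_qr that s1(2) s2(2) gcd_unit_cong[OF s(1), of j] gcd_unit_cong[OF s(2), of j]
      by (intro gcd_mult_eqI) auto
    ultimately show ?thesis by blast
  qed auto
qed

text \<open>
  Below \<open>e = m - 1\<close> the unit \<open>1 + p\<^sup>e\<close> works, since \<open>b\<close> is invisible modulo \<open>p\<^bsup>m-1\<^esup>\<close>; it is a unit for \<open>e = 0\<close> because
  then \<open>p\<close> is odd. For \<open>e = m - 1\<close> the position \<open>j\<^sub>0\<close> of the entry divisible by \<open>p\<close> forces the unit \<open>b\<^bsup>-j\<^sub>0\<^esup>\<close>.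
\<close>

lemma ex_unit_p_power:
  assumes adm: "admissible e d"
  shows "\<exists>s. coprime s (int p) \<and> gcd (1 - s) (int (p ^ (m - 1))) = int (p ^ e) \<and>
      (\<forall>j<p. gcd (1 - s * b ^ j) (int (p ^ m)) = int (p ^ e) * gcd (int (d ! j)) (int p))"
proof -
  have e: "e \<le> m - 1" "p = 2 \<Longrightarrow> 1 \<le> e" "(\<exists>j<p. p dvd d ! j) \<longleftrightarrow> e = m - 1"
    using adm unfolding admissible_def by blast+
  note cop = admissible_coprime[OF adm]
  have gcd_p: "gcd (int (d ! j)) (int p) = (if p dvd d ! j then int p else 1)" for j
  proof (cases "p dvd d ! j")
    case False
    hence "coprime (d ! j) p"
      using prime_p by (metis coprime_commute prime_imp_coprime_nat)
    thus ?thesis using False by simp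
  qed (simp add: gcd_proj2_iff)
  show ?thesis
  proof (cases "e = m - 1")
    case False
    hence lt: "e < m - 1" using e(1) by simp
    define s where "s = 1 + int (p ^ e)"
    have not_dvd: "\<not> int (p ^ (e + 1)) dvd 1 - s * b ^ j" for j
    proof
      assume dvd: "int (p ^ (e + 1)) dvd 1 - s * b ^ j"
      have "int (p ^ (e + 1)) dvd int (p ^ (m - 1))"
        using lt le_imp_power_dvd[of "e + 1" "m - 1" p] by (simp only: int_dvd_int_iff)
      hence "int (p ^ (e + 1)) dvd 1 - s"
        using dvd cong_1_p_part[of s j] by (metis cong_dvd_modulus cong_dvd_iff)
      hence "p ^ (e + 1) dvd p ^ e"
        by (simp add: s_def)
      thus False using p_ge_2 by (simp add: dvd_power_iff_le)
    qed
    have dvd: "int (p ^ e) dvd 1 - s * b ^ j" for j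
    proof -
      have "int (p ^ e) dvd int (p ^ (m - 1))"
        using e(1) le_imp_power_dvd[of e "m - 1" p] by (simp only: int_dvd_int_iff)
      moreover have "int (p ^ e) dvd 1 - s" by (simp add: s_def)
      ultimately show ?thesis
        using cong_1_p_part[of s j] by (metis cong_dvd_modulus cong_dvd_iff)
    qed
    have "coprime s (int p)"
    proof (cases e)
      case 0
      hence "odd p" using e(2) prime_odd_nat[OF prime_p] p_ge_2 by force
      thus ?thesis using 0 by (simp add: s_def)
    next
      case (Suc e')
      have "gcd (int p) (int (p ^ e') * int p + 1) = 1"
        by (simp only: gcd_add_mult) simp
      moreover have "s = int (p ^ e') * int p + 1"
        by (simp add: s_def Suc mult.commute)
      ultimately show ?thesis
        by (metis coprime_iff_gcd_eq_1 gcd.commute)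
    qed
    moreover have "gcd (1 - s) (int (p ^ (m - 1))) = int (p ^ e)"
      using dvd[of 0] not_dvd[of 0] e(1) by (intro gcd_prime_power_eqI prime_p) auto
    moreover have "gcd (1 - s * b ^ j) (int (p ^ m)) = int (p ^ e) * gcd (int (d ! j)) (int p)" if "j < p" for j
    proof -
      have "gcd (1 - s * b ^ j) (int (p ^ m)) = int (p ^ e)"
        using e(1) by (intro gcd_prime_power_eqI prime_p dvd not_dvd) auto
      moreover have "\<not> p dvd d ! j" using e(3) False that by blast
      ultimately show ?thesis using gcd_p[of j] by simp
    qed
    ultimately show ?thesis by blast
  next
    case True
    then obtain j0 where j0: "j0 < p" "p dvd d ! j0" using e(3) by blast
    define s where "s = b ^ (p - j0)"
    have pm: "int (p ^ m) = int (p ^ e) * int p"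
      using True m_ge_2 by (cases m) auto
    have "int p dvd N" using m_ge_2 by (simp add: dvd_power)
    hence "coprime s (int p)"
      using coprime_b unfolding s_def by simp
    moreover have dvd: "int (p ^ (m - 1)) dvd 1 - b ^ k" for k
      using cong_1_p_part[of 1 k] by (simp add: cong_dvd_iff)
    hence "gcd (1 - s) (int (p ^ (m - 1))) = int (p ^ e)"
      unfolding s_def True by (simp add: gcd_proj2_iff)
    moreover have "gcd (1 - s * b ^ j) (int (p ^ m)) = int (p ^ e) * gcd (int (d ! j)) (int p)" if j: "j < p" for j
    proof (cases "j = j0")
      case True
      have "[b ^ p = 1] (mod int (p ^ m))"
        by (rule cong_dvd_modulus[OF power_p_cong_1]) simp
      moreover have "s * b ^ j = b ^ p"
        using j0(1) by (simp add: s_def True flip: power_add)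
      ultimately have "int (p ^ m) dvd 1 - s * b ^ j"
        by (simp add: cong_iff_dvd_diff dvd_diff_commute)
      hence "gcd (1 - s * b ^ j) (int (p ^ m)) = int (p ^ m)"
        by (simp add: gcd_proj2_iff)
      thus ?thesis using j0(2) True pm gcd_p[of j] by simp
    next
      case False
      have "\<not> int (p ^ m) dvd 1 - s * b ^ j"
      proof
        assume "int (p ^ m) dvd 1 - s * b ^ j"
        hence "int (p ^ m) dvd b ^ (p - j0 + j) - 1"
          by (simp add: s_def power_add dvd_diff_commute)
        moreover have "\<not> p dvd p - j0 + j"
          using not_dvd_diff_add[OF j0(1) j False] .
        ultimately show False
          using dvd_power_pred_imp_dvd_pred[of "int (p ^ m)" "p - j0 + j"] p_part_not_dvd_pred by simp
      qed
      moreover have "int (p ^ (m - 1)) dvd 1 - s * b ^ j"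
        using dvd[of "p - j0 + j"] by (simp add: s_def power_add)
      ultimately have "gcd (1 - s * b ^ j) (int (p ^ m)) = int (p ^ e)"
        unfolding True using m_ge_2 by (intro gcd_prime_power_eqI prime_p) auto
      moreover have "\<not> p dvd d ! j"
        using cop[OF j j0(1) False] j0(2) prime_p by (metis coprime_common_divisor not_prime_unit)
      ultimately show ?thesis using gcd_p[of j] by simp
    qed
    ultimately show ?thesis by blast
  qed
qed

lemma admissible_realised:
  assumes adm: "admissible e d"
  shows "\<exists>s. coprime s N \<and> realises s e d"
proof -
  have d: "d ! j dvd n * p" if "j < p" for j
    using adm that by (simp add: admissible_def coprime_divisor_tuples_def)
  obtain s1 where s1: "coprime s1 (int n)"
      "\<forall>j<p. gcd (1 - s1 * b ^ j) (int n) = gcd (int (d ! j)) (int n)"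
    using ex_unit_dvd_n[OF dvd_refl, of "\<lambda>j. d ! j"] admissible_coprime[OF adm] adm
    unfolding admissible_def by blast
  obtain s2 where s2: "coprime s2 (int p)" "gcd (1 - s2) (int (p ^ (m - 1))) = int (p ^ e)"
      "\<forall>j<p. gcd (1 - s2 * b ^ j) (int (p ^ m)) = int (p ^ e) * gcd (int (d ! j)) (int p)"
    using ex_unit_p_power[OF adm] by blast
  have coprime_np: "coprime (int n) (int (p ^ m))"
    using coprime_n_p by simp
  obtain s where s: "[s = s1] (mod int n)" "[s = s2] (mod int (p ^ m))"
    using binary_chinese_remainder_int[OF coprime_np] by blast
  have "coprime s (int n)" "coprime s (int (p ^ m))"
    using s1(1) s2(1) cong_imp_coprime[OF cong_sym[OF s(1)]] cong_imp_coprime[OF cong_sym[OF s(2)]]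
    by auto
  hence "coprime s N" by simp
  moreover have "common s = int (p ^ e)"
  proof -
    have "[s = s2] (mod int (p ^ (m - 1)))"
      using s(2) by (rule cong_dvd_modulus) (simp add: le_imp_power_dvd)
    hence "gcd (1 - s) (int (p ^ (m - 1))) = gcd (1 - s2) (int (p ^ (m - 1)))"
      by (intro cong_gcd_eq cong_diff cong_refl)
    thus ?thesis using s2(2) by (simp only: common_def)
  qed
  moreover have "modulus s j = int (p ^ e) * int (d ! j)" if j: "j < p" for j
  proof -
    have "modulus s j = gcd (1 - s * b ^ j) (int n) * gcd (1 - s * b ^ j) (int (p ^ m))"
      unfolding modulus_def of_nat_mult using coprime_np by (rule gcd_coprime_mult)
    also have "\<dots> = gcd (int (d ! j)) (int n) * (int (p ^ e) * gcd (int (d ! j)) (int p))"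
      using gcd_unit_cong[OF s(1), of j] gcd_unit_cong[OF s(2), of j] s1(2) s2(3) j by simp
    also have "\<dots> = int (p ^ e) * gcd (int (d ! j)) (int n * int p)"
      using coprime_n_p by (simp add: gcd_coprime_mult)
    also have "gcd (int (d ! j)) (int n * int p) = int (d ! j)"
      using d[OF j] by (simp add: gcd_proj1_iff flip: of_nat_mult)
    finally show ?thesis .
  qed
  ultimately show ?thesis by (auto simp: realises_def)
qed

end

section \<open>Automorphisms of the metacyclic group\<close>

text \<open>
  A coordinate description of \<open>C\<^sub>N \<rtimes> C\<^sub>p\<close>: \<open>E i j\<close> is \<open>x\<^sup>i z\<^sup>j\<close> for generators \<open>x\<close> and \<open>z\<close> with \<open>z x z\<^sup>-\<^sup>1 = x\<^sup>b\<close>.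
  Coordinates are arbitrary representatives, compared by congruences, so that no computation
  involves reductions. Natural exponents for \<open>z\<close> keep the powers of \<open>b\<close> integral.
\<close>

locale metacyclic_group = unit_of_order_p n m p b + group G
  for n m p b and G (structure) +
  fixes E :: "int \<Rightarrow> nat \<Rightarrow> 'a"
  assumes E_surj: "carrier G = range (\<lambda>(i, j). E i j)"
    and E_eq_iff: "E i j = E k l \<longleftrightarrow> [i = k] (mod N) \<and> [j = l] (mod p)"
    and E_mult: "E i j \<otimes> E k l = E (i + b ^ j * k) (j + l)"
begin

lemma E_closed [simp]: "E i j \<in> carrier G"
  unfolding E_surj by (auto intro: image_eqI[of _ _ "(i, j)"])

lemma E_cases:
  assumes "g \<in> carrier G"
  obtains i j where "g = E i j"
  using assms unfolding E_surj by auto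

lemma one_eq_E: "\<one> = E 0 0"
  using E_mult[of 0 0 0 0] r_cancel_one'[of "E 0 0" "E 0 0"] by simp

lemma E_pow_base: "E i 0 [^] (k::nat) = E (int k * i) 0"
  by (induction k) (simp_all add: one_eq_E E_mult algebra_simps)

lemma E_pow_top: "E t 1 [^] (k::nat) = E (t * (\<Sum>i<k. b ^ i)) k"
  by (induction k) (simp_all add: one_eq_E E_mult algebra_simps)

lemma E_pow_snd: "\<exists>i'. E i j [^] (k::nat) = E i' (k * j)"
proof (induction k)
  case (Suc k)
  then obtain i' where "E i j [^] k = E i' (k * j)" by blast
  thus ?case by (auto simp: E_mult add.commute)
qed (auto simp: one_eq_E)

text \<open>
  The subgroup \<open>C\<^sub>N\<close> is the centraliser of \<open>C\<^sub>n\<close>, and \<open>C\<^sub>n\<close> is mapped into \<open>C\<^sub>N\<close> because its order is prime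
  to the index \<open>p\<close>. Hence \<open>C\<^sub>N\<close> is invariant under automorphisms.
\<close>

lemma auto_preserves_base:
  assumes \<phi>: "\<phi> \<in> auto G"
  obtains s where "coprime s N" "\<And>i. \<phi> (E i 0) = E (s * i) 0"
proof -
  interpret \<phi>: group_hom G G \<phi>
    using \<phi> by unfold_locales (simp add: auto_def)
  have inj: "E i j = E k l" if "\<phi> (E i j) = \<phi> (E k l)" for i j k l
    using \<phi> that by (auto simp: auto_def Bij_def bij_betw_def dest: inj_onD)
  \<comment> \<open>The element \<open>E u 0\<close> generates \<open>C\<^sub>n\<close>.\<close>
  define u where "u = int (p ^ m)"
  obtain i0 k0 where U: "\<phi> (E u 0) = E i0 k0"
    using E_cases[OF \<phi>.hom_closed[OF E_closed]] by blast
  have U_pow: "\<phi> (E u 0) [^] n = E 0 0"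
  proof -
    have "E u 0 [^] n = E 0 0"
      by (simp add: E_pow_base E_eq_iff u_def cong_0_iff)
    thus ?thesis by (metis E_closed \<phi>.hom_nat_pow \<phi>.hom_one one_eq_E)
  qed
  obtain i1 where "E i0 k0 [^] n = E i1 (n * k0)"
    using E_pow_snd by blast
  hence "[n * k0 = 0] (mod p)"
    using U_pow U by (simp add: E_eq_iff)
  hence "p dvd k0"
    using coprime_n_p by (simp add: cong_0_iff coprime_commute coprime_dvd_mult_right_iff)
  hence U: "\<phi> (E u 0) = E i0 0"
    unfolding U E_eq_iff by (simp add: cong_0_iff)
  have "N dvd int n * i0"
    using U_pow unfolding U E_pow_base E_eq_iff by (simp add: cong_0_iff)
  hence u_dvd: "u dvd i0"
    using n_ge_2 by (simp add: u_def)
  obtain s k where X: "\<phi> (E 1 0) = E s k"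
    using E_cases[OF \<phi>.hom_closed[OF E_closed]] by blast
  have "\<phi> (E 1 0 \<otimes> E u 0) = \<phi> (E u 0 \<otimes> E 1 0)"
    by (simp add: E_mult add.commute)
  hence "E s k \<otimes> E i0 0 = E i0 0 \<otimes> E s k"
    by (simp only: \<phi>.hom_mult E_closed X U)
  hence "[s + b ^ k * i0 = s + i0] (mod N)"
    unfolding E_mult E_eq_iff by (simp add: add.commute)
  hence fixed: "[b ^ k * i0 = i0] (mod N)"
    by (simp only: cong_add_lcancel)
  \<comment> \<open>Otherwise \<open>\<phi> x\<close> would act freely on \<open>C\<^sub>n\<close> while it commutes with \<open>\<phi> (E u 0)\<close>.\<close>
  have "p dvd k"
  proof (rule ccontr)
    assume "\<not> p dvd k"
    hence "[b * i0 = i0] (mod N)"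
      using power_fixes_imp_fixes[OF dvd_refl _ fixed] by blast
    hence "N dvd (b - 1) * i0"
      by (simp add: cong_iff_dvd_diff algebra_simps)
    hence "int n dvd (b - 1) * i0"
      by (metis dvd_mult_left of_nat_mult)
    hence "int n dvd i0"
      using coprime_pred_n by (simp add: coprime_commute coprime_dvd_mult_right_iff)
    hence "N dvd i0"
      using u_dvd coprime_n_p unfolding of_nat_mult u_def by (intro divides_mult) auto
    hence "\<phi> (E u 0) = \<phi> (E 0 0)"
      using \<phi>.hom_one unfolding U one_eq_E by (simp add: E_eq_iff cong_0_iff)
    from inj[OF this] have "n * p ^ m dvd p ^ m"
      by (simp only: E_eq_iff u_def cong_0_iff int_dvd_int_iff)
    thus False using n_ge_2 p_pos by simp
  qed
  hence X: "\<phi> (E 1 0) = E s 0"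
    unfolding X E_eq_iff by (simp add: cong_0_iff)
  have base: "\<phi> (E i 0) = E (s * i) 0" for i
  proof -
    define k where "k = nat (i mod N)"
    have k: "[i = int k] (mod N)"
      using N_pos by (simp add: k_def cong_def)
    hence "E i 0 = E 1 0 [^] k"
      by (simp add: E_pow_base E_eq_iff)
    hence "\<phi> (E i 0) = \<phi> (E 1 0) [^] k"
      by (simp only: \<phi>.hom_nat_pow E_closed)
    also have "\<dots> = E (int k * s) 0"
      unfolding X E_pow_base ..
    also have "\<dots> = E (s * i) 0"
      using cong_scalar_left[OF k, of s] by (simp add: E_eq_iff mult.commute cong_sym_eq)
    finally show ?thesis .
  qed
  have "coprime s N"
  proof -
    define g where "g = gcd s N"
    obtain N' where N': "N = g * N'" unfolding g_def by (metis dvdE gcd_dvd2)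
    obtain s' where s': "s = g * s'" unfolding g_def by (metis dvdE gcd_dvd1)
    have "N dvd s * N'" unfolding N' s' by (simp add: mult.left_commute mult.assoc)
    hence "\<phi> (E N' 0) = \<phi> (E 0 0)"
      unfolding base by (simp add: E_eq_iff cong_0_iff)
    from inj[OF this] have "g * N' dvd 1 * N'"
      by (simp add: E_eq_iff cong_0_iff flip: N')
    hence "g dvd 1" using N_pos unfolding N' by (subst (asm) dvd_mult_cancel_right) auto
    thus ?thesis unfolding g_def by (simp only: is_unit_gcd)
  qed
  thus ?thesis using base that by blast
qed

text \<open>
  The image of \<open>z\<close> has to act on \<open>C\<^sub>N\<close> like \<open>z\<close>, so it is \<open>x\<^sup>t z\<close>; it has to be of order \<open>p\<close>, which forces \<open>t\<close> to be a
  multiple of \<open>p\<^bsup>m-1\<^esup> = gcd (b - 1) N\<close>. So \<open>t = c (b - 1)\<close>, and the automorphism differs from \<open>x\<^sup>i z\<^sup>j \<mapsto> x\<^bsup>si\<^esup> z\<^sup>j\<close> only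
  by the inner automorphism of \<open>x\<^bsup>-c\<^esup>\<close>.
\<close>

lemma auto_normal_form:
  assumes \<phi>: "\<phi> \<in> auto G"
  obtains s c where "coprime s N" "\<And>i j. \<phi> (E i j) = E (s * i + c * (b ^ j - 1)) j"
proof -
  interpret \<phi>: group_hom G G \<phi>
    using \<phi> by unfold_locales (simp add: auto_def)
  obtain s where s: "coprime s N" and base: "\<And>i. \<phi> (E i 0) = E (s * i) 0"
    using auto_preserves_base[OF \<phi>] by blast
  obtain t l where Y: "\<phi> (E 0 1) = E t l"
    using E_cases[OF \<phi>.hom_closed[OF E_closed]] by blast
  \<comment> \<open>The images satisfy the defining relation \<open>z x = x\<^sup>b z\<close>.\<close>
  have "\<phi> (E 0 1 \<otimes> E 1 0) = \<phi> (E b 0 \<otimes> E 0 1)"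
    by (simp add: E_mult)
  hence "E t l \<otimes> E (s * 1) 0 = E (s * b) 0 \<otimes> E t l"
    by (simp only: \<phi>.hom_mult E_closed base Y)
  hence "[b ^ l * s = s * b] (mod N)"
    by (simp add: E_mult E_eq_iff add.commute[of t] cong_add_rcancel)
  hence "[b ^ l = b] (mod N)"
    using s by (simp add: mult.commute[of s] cong_mult_rcancel)
  hence "[b ^ (p - 1) * b ^ l = b ^ (p - 1) * b] (mod N)"
    by (rule cong_scalar_left)
  moreover have "b ^ (p - 1) * b = b ^ p"
    using p_pos by (simp flip: power_Suc2)
  ultimately have "[b ^ (p - 1 + l) = 1] (mod N)"
    using power_p_cong_1 by (simp add: power_add) (metis cong_trans)
  hence "int n dvd b ^ (p - 1 + l) - 1"
    unfolding cong_iff_dvd_diff by (rule dvd_trans[rotated]) simp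
  hence "p dvd p - 1 + l" by (simp add: n_dvd_power_pred_iff)
  hence "[p - 1 + l = p - 1 + 1] (mod p)"
    using p_pos by (simp add: cong_def dvd_eq_mod_eq_0)
  hence "[l = 1] (mod p)" by (simp only: cong_add_lcancel_nat)
  hence Y: "\<phi> (E 0 1) = E t 1" unfolding Y E_eq_iff by simp
  have "E 0 1 [^] p = E 0 0"
    unfolding E_pow_top E_eq_iff by (simp add: cong_0_iff)
  hence "E t 1 [^] p = E 0 0"
    by (metis E_closed Y \<phi>.hom_nat_pow \<phi>.hom_one one_eq_E)
  hence "N dvd t * (\<Sum>i<p. b ^ i)"
    unfolding E_pow_top E_eq_iff by (simp add: cong_0_iff)
  hence "gcd (b - 1) N dvd t"
    unfolding gcd_pred_N by (rule p_part_dvd_if_dvd_mult_geometric_sum)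
  then obtain c where "N dvd t - c * (b - 1)"
    using ex_dvd_diff_mult_iff by blast
  hence c: "[t = c * (b - 1)] (mod N)" by (simp add: cong_iff_dvd_diff)
  have "\<phi> (E i j) = E (s * i + c * (b ^ j - 1)) j" for i j
  proof -
    have "E i j = E i 0 \<otimes> E 0 1 [^] j"
      unfolding E_pow_top E_mult by simp
    hence "\<phi> (E i j) = \<phi> (E i 0) \<otimes> \<phi> (E 0 1) [^] j"
      by (simp only: \<phi>.hom_mult \<phi>.hom_nat_pow E_closed nat_pow_closed)
    also have "\<dots> = E (s * i + t * (\<Sum>i<j. b ^ i)) j"
      unfolding base Y E_pow_top E_mult by simp
    also have "\<dots> = E (s * i + c * (b - 1) * (\<Sum>i<j. b ^ i)) j"
      unfolding E_eq_iff using c by (intro conjI cong_add cong_refl cong_scalar_right)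
    finally show ?thesis
      by (simp add: power_diff_1_eq mult.assoc)
  qed
  thus ?thesis using s that by blast
qed

lemma ex_auto_scaling_base:
  assumes s: "coprime s N"
  shows "\<exists>\<phi>\<in>auto G. \<forall>i j. \<phi> (E i j) = E (s * i) j"
proof -
  \<comment> \<open>A choice of coordinates; the formula for \<open>\<phi>\<close> does not depend on it.\<close>
  define co where "co = (\<lambda>g. SOME u. g = E (fst u) (snd u))"
  define \<phi> where "\<phi> = (\<lambda>g\<in>carrier G. E (s * fst (co g)) (snd (co g)))"
  have \<phi>: "\<phi> (E i j) = E (s * i) j" for i j
  proof -
    have "E i j = E (fst (co (E i j))) (snd (co (E i j)))"
      unfolding co_def by (rule someI[of _ "(i, j)"]) simp
    hence "[i = fst (co (E i j))] (mod N)" "[j = snd (co (E i j))] (mod p)"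
      unfolding E_eq_iff by blast+
    thus ?thesis by (simp add: \<phi>_def E_eq_iff cong_sym_eq cong_scalar_left)
  qed
  have "\<phi> \<in> hom G G"
  proof (rule homI)
    fix g h assume "g \<in> carrier G" "h \<in> carrier G"
    thus "\<phi> (g \<otimes> h) = \<phi> g \<otimes> \<phi> h"
      by (elim E_cases) (simp add: \<phi> E_mult algebra_simps)
  qed (metis E_cases E_closed \<phi>)
  moreover have "bij_betw \<phi> (carrier G) (carrier G)"
    unfolding bij_betw_def
  proof
    show "inj_on \<phi> (carrier G)"
    proof (rule inj_onI)
      fix g h assume g: "g \<in> carrier G" and h: "h \<in> carrier G" and eq: "\<phi> g = \<phi> h"
      obtain i j where "g = E i j" using E_cases[OF g] .
      moreover obtain k l where "h = E k l" using E_cases[OF h] .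
      ultimately show "g = h" using eq s by (simp add: \<phi> E_eq_iff cong_mult_lcancel)
    qed
    obtain s' where s': "[s * s' = 1] (mod N)" using s cong_solve_coprime_int by blast
    have "E i j = \<phi> (E (s' * i) j)" for i j
      using cong_scalar_right[OF s', of i] by (simp add: \<phi> E_eq_iff cong_sym_eq mult.assoc)
    thus "\<phi> ` carrier G = carrier G"
      by (metis (no_types, lifting) E_cases E_closed \<phi> image_eqI subsetI subset_antisym image_subsetI)
  qed
  moreover have "\<phi> \<in> extensional (carrier G)" by (simp add: \<phi>_def)
  ultimately have "\<phi> \<in> auto G" by (simp add: auto_def Bij_def)
  thus ?thesis using \<phi> by blast
qed

end

section \<open>Reidemeister numbers\<close>

text \<open>
  Classes are counted by a complete invariant: \<open>e\<close> lists the elements of \<open>A\<close>, possibly with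
  repetitions, and two of them are related exactly when their keys agree.
\<close>

lemma card_quotient_eq_card_range_key:
  assumes carrier: "A = range e" and R: "R \<subseteq> A \<times> A"
    and key: "\<And>u v. (e u, e v) \<in> R \<longleftrightarrow> key u = key v"
  shows "card (A // R) = card (range key)"
proof -
  define cls where "cls = (\<lambda>k. {e v | v. key v = k})"
  have cls: "R `` {e u} = cls (key u)" for u
  proof (intro equalityI subsetI)
    fix y assume y: "y \<in> R `` {e u}"
    hence "y \<in> range e" using R carrier by blast
    then obtain v where "y = e v" by blast
    with y show "y \<in> cls (key u)" by (auto simp: cls_def key)
  qed (auto simp: cls_def key)
  have "A // R = cls ` range key"
    by (auto simp: quotient_def carrier cls)
  moreover have "inj_on cls (range key)"
  proof (intro inj_onI; elim imageE; clarify)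
    fix u v assume "cls (key u) = cls (key v)"
    moreover have "e u \<in> cls (key u)" by (auto simp: cls_def)
    ultimately have "e u \<in> cls (key v)" by simp
    then obtain w where w: "e u = e w" "key w = key v" by (auto simp: cls_def)
    have "(e u, e w) \<in> R" using w(1) key[of w w] by simp
    thus "key u = key v" using key w(2) by simp
  qed
  ultimately show ?thesis by (simp add: card_image)
qed

context metacyclic_group
begin

text \<open>
  Twisted conjugation preserves the coset of \<open>C\<^sub>N\<close>, since the automorphism is trivial modulo \<open>C\<^sub>N\<close>. Within
  the coset \<open>j\<close>, conjugation by \<open>x\<^sup>r\<close> adds multiples of \<open>1 - s b\<^sup>j\<close> to the exponent, and conjugation by powers
  of \<open>z\<close> multiplies it by powers of \<open>b\<close>, once the exponent is shifted by \<open>c b\<^sup>j\<close> to absorb the inner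
  automorphism.
\<close>

lemma reidemeister_number_formula:
  assumes \<phi>: "\<And>i j. \<phi> (E i j) = E (s * i + c * (b ^ j - 1)) j"
  shows "reidemeister_number G \<phi> = (\<Sum>j<p. card (range (orb (modulus s j))))"
proof -
  define key where
    "key = (\<lambda>(i, j). (j mod p, orb (modulus s j) (i - c * b ^ j)))"
  have rel_iff: "(E i j, E i' j') \<in> twisted_conj_rel G \<phi> \<longleftrightarrow> key (i, j) = key (i', j')" for i j i' j'
  proof -
    have "(E i j, E i' j') \<in> twisted_conj_rel G \<phi>
        \<longleftrightarrow> (\<exists>r k. E i j = E r k \<otimes> E i' j' \<otimes> inv (\<phi> (E r k)))"
      unfolding twisted_conj_rel_def by (auto elim!: E_cases)
    also have "\<dots> \<longleftrightarrow> (\<exists>r k. E r k \<otimes> E i' j' = E i j \<otimes> \<phi> (E r k))"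
      by (simp add: \<phi> inv_solve_right)
    also have "\<dots> \<longleftrightarrow> (\<exists>k r. N dvd (r + b ^ k * i') - (i + b ^ j * (s * r + c * (b ^ k - 1))) \<and>
        [j' = j] (mod p))"
      unfolding \<phi> E_mult E_eq_iff cong_iff_dvd_diff
      by (auto simp: add.commute[of j] cong_add_lcancel_nat)
    \<comment> \<open>Both exponents are shifted: \<open>i\<close> by \<open>c b\<^sup>j\<close>, and \<open>i'\<close> by \<open>c\<close> times \<open>b\<close> to the power \<open>j'\<close>.\<close>
    also have "\<dots> \<longleftrightarrow> [j = j'] (mod p) \<and>
        (\<exists>k r. N dvd (i - c * b ^ j - b ^ k * (i' - c * b ^ j')) - r * (1 - s * b ^ j))"
    proof (cases "[j = j'] (mod p)")
      case True
      hence bj: "[b ^ j' = b ^ j] (mod N)"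
        by (intro power_cong_of_exponent_cong dvd_refl) (rule cong_sym)
      have "N dvd (r + b ^ k * i') - (i + b ^ j * (s * r + c * (b ^ k - 1))) \<longleftrightarrow>
          N dvd (i - c * b ^ j - b ^ k * (i' - c * b ^ j')) - r * (1 - s * b ^ j)" for k r
      proof -
        have "(i - c * b ^ j - b ^ k * (i' - c * b ^ j')) - r * (1 - s * b ^ j) =
            - ((r + b ^ k * i') - (i + b ^ j * (s * r + c * (b ^ k - 1)))) + (b ^ k * c) * (b ^ j' - b ^ j)"
          by (simp add: algebra_simps)
        moreover have "N dvd (b ^ k * c) * (b ^ j' - b ^ j)"
          using bj unfolding cong_iff_dvd_diff by (rule dvd_mult)
        ultimately show ?thesis by (metis dvd_add_left_iff dvd_minus_iff)
      qed
      thus ?thesis using True by (simp only: cong_sym_eq[of j' j] simp_thms)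
    qed (simp add: cong_sym_eq)
    also have "\<dots> \<longleftrightarrow> [j = j'] (mod p) \<and>
        (\<exists>k. [i - c * b ^ j = b ^ k * (i' - c * b ^ j')] (mod modulus s j))"
      unfolding ex_dvd_diff_mult_iff cong_iff_dvd_diff modulus_def by (rule refl)
    also have "\<dots> \<longleftrightarrow> key (i, j) = key (i', j')"
      unfolding orb_eq_iff[OF modulus_dvd_N, symmetric]
      unfolding key_def prod.case prod.inject
      using modulus_cong[of j j' s] unfolding cong_def[of j j' p] by metis
    finally show ?thesis .
  qed
  have "reidemeister_number G \<phi> = card (range key)"
    unfolding reidemeister_number_def
  proof (rule card_quotient_eq_card_range_key[OF E_surj])
    show "twisted_conj_rel G \<phi> \<subseteq> carrier G \<times> carrier G"
      by (auto simp: twisted_conj_rel_def)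
  qed (auto simp: rel_iff split: prod.splits)
  also have "range key = (SIGMA j:{..<p}. range (orb (modulus s j)))"
  proof (intro equalityI subsetI)
    fix z assume "z \<in> range key"
    then obtain i j where z: "z = key (i, j)" by auto
    have "modulus s j = modulus s (j mod p)"
      by (rule modulus_cong) (simp add: cong_def)
    thus "z \<in> (SIGMA j:{..<p}. range (orb (modulus s j)))"
      using p_pos by (auto simp: z key_def)
  next
    fix z assume "z \<in> (SIGMA j:{..<p}. range (orb (modulus s j)))"
    then obtain j w where "j < p" "z = (j, orb (modulus s j) w)" by auto
    hence "z = key (w + c * b ^ j, j)" by (simp add: key_def)
    thus "z \<in> range key" by blast
  qed
  also have "card \<dots> = (\<Sum>j<p. card (range (orb (modulus s j))))"
    using modulus_dvd_N modulus_pos by (intro card_SigmaI) (auto simp: range_orb)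
  finally show ?thesis .
qed

text \<open>
  Each coset contributes \<open>(D + (p - 1) p\<^sup>e) / p\<close> orbits with \<open>D = p\<^sup>e d\<^sub>j\<close> its modulus.
\<close>

lemma p_times_reidemeister_number:
  assumes \<phi>: "\<And>i j. \<phi> (E i j) = E (s * i + c * (b ^ j - 1)) j" and adm: "admissible e d"
    and s: "realises s e d"
  shows "p * reidemeister_number G \<phi> = p ^ e * (sum_list d + p * (p - 1))"
proof -
  have d: "length d = p" using adm by (simp add: admissible_def coprime_divisor_tuples_def)
  have "int (p * reidemeister_number G \<phi>) = (\<Sum>j<p. int p * int (card (range (orb (modulus s j)))))"
    by (simp add: reidemeister_number_formula[OF \<phi>] sum_distrib_left)
  also have "\<dots> = (\<Sum>j<p. int (p ^ e) * int (d ! j) + int (p - 1) * int (p ^ e))"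
    unfolding card_orbits[OF modulus_dvd_N modulus_pos] gcd_pred_modulus
    using s p_pos by (intro sum.cong) (simp_all add: realises_def of_nat_diff)
  also have "\<dots> = int (\<Sum>j<p. p ^ e * d ! j + (p - 1) * p ^ e)"
    by (simp only: of_nat_sum of_nat_add of_nat_mult)
  also have "(\<Sum>j<p. p ^ e * d ! j + (p - 1) * p ^ e) = p ^ e * (\<Sum>j<p. d ! j) + p * ((p - 1) * p ^ e)"
    by (simp add: sum.distrib sum_distrib_left)
  also have "(\<Sum>j<p. d ! j) = sum_list d"
    using d by (simp add: sum_list_sum_nth atLeast0LessThan)
  also have "p ^ e * sum_list d + p * ((p - 1) * p ^ e) = p ^ e * (sum_list d + p * (p - 1))"
    by (simp only: distrib_left mult_ac)
  finally show ?thesis by (simp only: of_nat_eq_iff)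
qed

lemma of_nat_reidemeister_spectrum:
  "(of_nat ` reidemeister_spectrum G :: rat set) =
     {of_nat p powi (int e + 1) + of_nat p powi (int e - 1) * (of_nat (sum_list d) - of_nat p) | e d.
        admissible e d}"
proof -
  have pq: "(of_nat p :: rat) \<noteq> 0" using p_pos by simp
  have value_iff: "p * R = p ^ e * (sum_list d + p * (p - 1)) \<longleftrightarrow>
      (of_nat R :: rat) = of_nat p powi (int e + 1) + of_nat p powi (int e - 1) * (of_nat (sum_list d) - of_nat p)"
    for R e d
  proof -
    define q :: rat where "q = of_nat p"
    have q: "q \<noteq> 0" using pq by (simp add: q_def)
    have "p * R = p ^ e * (sum_list d + p * (p - 1)) \<longleftrightarrow>
        (of_nat (p * R) :: rat) = of_nat (p ^ e * (sum_list d + p * (p - 1)))"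
      by (simp only: of_nat_eq_iff)
    also have "\<dots> \<longleftrightarrow> q * of_nat R = q ^ e * (of_nat (sum_list d) + q * (q - 1))"
      using p_pos by (simp add: q_def of_nat_diff)
    also have "\<dots> \<longleftrightarrow> of_nat R = q ^ e * (of_nat (sum_list d) + q * (q - 1)) / q"
      using q by (auto simp: field_simps)
    also have "q ^ e * (of_nat (sum_list d) + q * (q - 1)) / q =
        q powi (int e + 1) + q powi (int e - 1) * (of_nat (sum_list d) - q)"
      using q by (simp add: power_int_add power_int_diff field_simps)
    finally show ?thesis unfolding q_def .
  qed
  show ?thesis
  proof (intro equalityI subsetI)
    fix v :: rat assume "v \<in> of_nat ` reidemeister_spectrum G"
    then obtain \<phi> where \<phi>: "\<phi> \<in> auto G" and v: "v = of_nat (reidemeister_number G \<phi>)"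
      unfolding reidemeister_spectrum_def by blast
    obtain s c where s: "coprime s N" and form: "\<And>i j. \<phi> (E i j) = E (s * i + c * (b ^ j - 1)) j"
      using auto_normal_form[OF \<phi>] by metis
    obtain e d where adm: "admissible e d" and "realises s e d"
      using unit_realises_admissible[OF s] by blast
    with form have "p * reidemeister_number G \<phi> = p ^ e * (sum_list d + p * (p - 1))"
      by (intro p_times_reidemeister_number)
    with adm show "v \<in> {of_nat p powi (int e + 1) + of_nat p powi (int e - 1) * (of_nat (sum_list d) - of_nat p) | e d.
        admissible e d}"
      unfolding value_iff v by blast
  next
    fix v :: rat
    assume "v \<in> {of_nat p powi (int e + 1) + of_nat p powi (int e - 1) * (of_nat (sum_list d) - of_nat p) | e d.
        admissible e d}"
    then obtain e d where adm: "admissible e d"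
        and v: "v = of_nat p powi (int e + 1) + of_nat p powi (int e - 1) * (of_nat (sum_list d) - of_nat p)"
      by blast
    obtain s where s: "coprime s N" "realises s e d" using admissible_realised[OF adm] by blast
    obtain \<phi> where "\<phi> \<in> auto G" "\<And>i j. \<phi> (E i j) = E (s * i) j"
      using ex_auto_scaling_base[OF s(1)] by blast
    moreover from this(2) have "p * reidemeister_number G \<phi> = p ^ e * (sum_list d + p * (p - 1))"
      by (intro p_times_reidemeister_number[of \<phi> s 0, OF _ adm s(2)]) simp
    ultimately show "v \<in> of_nat ` reidemeister_spectrum G"
      unfolding value_iff v reidemeister_spectrum_def by (metis imageI)
  qed
qed

end

section \<open>Semidirect products with a free action\<close>

lemma snd_int_pow_DirProd:
  assumes "group A" "group B" "g \<in> carrier (A \<times>\<times> B)"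
  shows "snd (g [^]\<^bsub>A \<times>\<times> B\<^esub> (k::int)) = snd g [^]\<^bsub>B\<^esub> k"
proof -
  have "snd \<in> hom (A \<times>\<times> B) B" by (auto simp: hom_def)
  hence "group_hom (A \<times>\<times> B) B snd"
    using assms DirProd_group by (simp add: group_hom_def group_hom_axioms_def)
  thus ?thesis using assms(3) by (rule group_hom.hom_int_pow)
qed

text \<open>
  The second coordinate counts powers of \<open>y\<^sup>-\<^sup>1\<close>: since \<open>y\<^sup>-\<^sup>1 x y = x\<^sup>a\<close>, this makes \<open>b = a\<close>, and no inverse of \<open>a\<close>
  modulo \<open>N\<close> is needed. Freeness of the action enters through the element \<open>x\<^bsup>h p^m\<^esup>\<close> with
  \<open>h = n / gcd (a - 1) n\<close>: it lies in \<open>C\<^sub>n\<close> and is fixed by \<open>C\<^sub>p\<close>, so it is trivial, and the gcd is \<open>1\<close>.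
\<close>

lemma metacyclic_group_smc:
  fixes n m p \<beta> :: nat and x :: "int \<times> int" and y a :: int
  assumes n: "n \<ge> 2" and m: "m \<ge> 2" and p: "Factorial_Ring.prime p" and cop: "gcd n p = 1"
    and m3: "p = 2 \<Longrightarrow> m \<ge> 3"
    and act: "smc_action n m p \<alpha>"
    and x: "x \<in> carrier (smc_base n m p)"
    and gen_x: "generate (smc_base n m p) {x} = carrier (smc_base n m p)"
    and y: "y \<in> carrier (integer_mod_group p)"
    and gen_y: "generate (integer_mod_group p) {y} = carrier (integer_mod_group p)"
    and \<alpha>yx: "\<alpha> y x = x [^]\<^bsub>smc_base n m p\<^esub> a"
    and \<beta>: "\<beta> \<in> {1..p - 1}"
    and a: "[a = int (\<beta> * p ^ (m - 1) + 1)] (mod int (p ^ m))"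
  shows "metacyclic_group n m p a (smc n m p \<alpha>)
    (\<lambda>i j. (x [^]\<^bsub>smc_base n m p\<^esub> i, (inv\<^bsub>integer_mod_group p\<^esub> y) [^]\<^bsub>integer_mod_group p\<^esub> j))"
proof -
  define H where "H = smc_base n m p"
  define K where "K = integer_mod_group p"
  interpret H: group H unfolding H_def by (intro DirProd_group) simp_all
  interpret K: comm_group K unfolding K_def by simp
  define N where "N = int (n * p ^ m)"
  have p_pos: "p > 0" using p prime_gt_0_nat by blast
  have coprime_np: "coprime n p" using cop unfolding coprime_iff_gcd_eq_1 .
  have hom: "\<alpha> \<in> hom K (AutoGroup H)"
    using act by (simp add: smc_action_def H_def K_def)
  note \<alpha>_rules = AutoGroup_homD[OF H.is_group K.is_group hom]
  have xH [simp]: "x \<in> carrier H" and yK [simp]: "y \<in> carrier K"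
    using x y by (simp_all add: H_def K_def)
  have ord_x: "H.ord x = n * p ^ m"
  proof -
    have "carrier H = {0..<int n} \<times> {0..<int (p ^ m)}"
      using n p_pos by (simp add: H_def carrier_integer_mod_group)
    hence "card (carrier H) = n * p ^ m" by (simp add: card_cartesian_product nat_power_eq)
    thus ?thesis using H.generate_pow_card[OF xH] gen_x by (simp add: H_def)
  qed
  have ord_y: "K.ord y = p"
  proof -
    have "card (carrier K) = p" using p_pos by (simp add: K_def carrier_integer_mod_group)
    thus ?thesis using K.generate_pow_card[OF yK] gen_y by (simp add: K_def)
  qed
  have x_eq: "x [^]\<^bsub>H\<^esub> i = x [^]\<^bsub>H\<^esub> k \<longleftrightarrow> [i = k] (mod N)" for i k :: int
    unfolding H.int_pow_eq[OF xH] ord_x N_def cong_iff_dvd_diff by (rule dvd_diff_commute)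
  have carrier_H: "carrier H = range (\<lambda>i::int. x [^]\<^bsub>H\<^esub> i)"
    using H.generate_pow[OF xH] gen_x by (auto simp: H_def)
  have carrier_K: "carrier K = range (\<lambda>i::int. y [^]\<^bsub>K\<^esub> i)"
    using K.generate_pow[OF yK] gen_y by (auto simp: K_def)
  define z where "z = inv\<^bsub>K\<^esub> y"
  have zK [simp]: "z \<in> carrier K" by (simp add: z_def)
  have z_eq: "z [^]\<^bsub>K\<^esub> i = z [^]\<^bsub>K\<^esub> k \<longleftrightarrow> [i = k] (mod p)" for i k :: nat
  proof -
    have "K.ord z = p" by (simp add: z_def ord_y)
    hence "z [^]\<^bsub>K\<^esub> int i = z [^]\<^bsub>K\<^esub> int k \<longleftrightarrow> [int k = int i] (mod int p)"
      unfolding K.int_pow_eq[OF zK] cong_iff_dvd_diff by simp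
    thus ?thesis
      unfolding int_pow_int cong_int_iff using cong_sym by blast
  qed
  have carrier_K_nat: "\<exists>k::nat. c = y [^]\<^bsub>K\<^esub> k" if "c \<in> carrier K" for c
  proof -
    obtain i :: int where i: "c = y [^]\<^bsub>K\<^esub> i"
      using \<open>c \<in> carrier K\<close> carrier_K by blast
    have "y [^]\<^bsub>K\<^esub> i = y [^]\<^bsub>K\<^esub> int (nat (i mod int p))"
      unfolding K.int_pow_eq[OF yK] ord_y mod_eq_dvd_iff[symmetric] using p_pos by simp
    thus ?thesis unfolding i int_pow_int by blast
  qed
  have \<alpha>_pow: "\<alpha> (y [^]\<^bsub>K\<^esub> j) (x [^]\<^bsub>H\<^esub> i) = x [^]\<^bsub>H\<^esub> (a ^ j * i)" for j :: nat and i :: int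
  proof (induction j)
    case (Suc j)
    interpret \<alpha>y: group_hom H H "\<alpha> y"
      using \<alpha>_rules(1)[OF yK] by unfold_locales
    have "\<alpha> (y [^]\<^bsub>K\<^esub> Suc j) (x [^]\<^bsub>H\<^esub> i) = \<alpha> y (\<alpha> (y [^]\<^bsub>K\<^esub> j) (x [^]\<^bsub>H\<^esub> i))"
      using \<alpha>_rules(3)[of y "y [^]\<^bsub>K\<^esub> j"] by (simp add: K.m_comm)
    also have "\<dots> = (x [^]\<^bsub>H\<^esub> a) [^]\<^bsub>H\<^esub> (a ^ j * i)"
      unfolding Suc \<alpha>y.hom_int_pow[OF xH] using \<alpha>yx by (simp add: H_def)
    finally show ?case by (simp add: H.int_pow_pow mult.assoc)
  qed (simp add: \<alpha>_rules(4))
  have power_p: "[a ^ p = 1] (mod N)"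
  proof -
    have "y [^]\<^bsub>K\<^esub> p = \<one>\<^bsub>K\<^esub>" using K.pow_ord_eq_1[OF yK] ord_y by simp
    hence "x [^]\<^bsub>H\<^esub> (a ^ p * 1) = x [^]\<^bsub>H\<^esub> (1::int)"
      unfolding \<alpha>_pow[symmetric] by (simp add: \<alpha>_rules(4))
    thus ?thesis unfolding x_eq by simp
  qed
  have free: "coprime (a - 1) (int n)"
  proof -
    define g where "g = gcd (a - 1) (int n)"
    obtain h where h: "int n = g * h" unfolding g_def by (metis dvdE gcd_dvd2)
    obtain r where r: "a - 1 = g * r" unfolding g_def by (metis dvdE gcd_dvd1)
    define w where "w = x [^]\<^bsub>H\<^esub> (h * int (p ^ m))"
    have w: "w \<in> carrier H" by (simp add: w_def)
    have "w [^]\<^bsub>H\<^esub> g = x [^]\<^bsub>H\<^esub> (0::int)"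
      unfolding w_def H.int_pow_pow[OF xH] x_eq by (simp add: N_def h cong_0_iff mult_ac)
    hence "snd w [^]\<^bsub>integer_mod_group (p ^ m)\<^esub> g = 0"
      using snd_int_pow_DirProd[of "integer_mod_group n" "integer_mod_group (p ^ m)" w g] w
      by (simp add: H_def)
    hence "int (p ^ m) dvd g * snd w"
      by (simp add: int_pow_integer_mod_group dvd_eq_mod_eq_0)
    moreover have "coprime g (int (p ^ m))"
    proof -
      have "g dvd int n" by (simp add: g_def)
      moreover have "coprime (int n) (int p)" using coprime_np by simp
      ultimately have "coprime g (int p)" by (rule coprime_divisors[OF _ dvd_refl])
      thus ?thesis by simp
    qed
    ultimately have "int (p ^ m) dvd snd w"
      by (simp add: coprime_commute coprime_dvd_mult_right_iff)
    hence "snd w mod int (p ^ m) = 0" by (simp only: dvd_eq_mod_eq_0)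
    moreover have fst_w: "fst w \<in> carrier (integer_mod_group n)"
        and snd_w: "snd w \<in> carrier (integer_mod_group (p ^ m))"
      using w by (auto simp: H_def)
    have "snd w mod int (p ^ m) = snd w"
      using snd_w p_pos by (simp add: carrier_integer_mod_group)
    ultimately have "snd w = 0" by simp
    hence w_eq: "w = (fst w, \<one>\<^bsub>integer_mod_group (p ^ m)\<^esub>)" by (simp add: prod_eq_iff)
    have "\<alpha> c w = w" if "c \<in> carrier K" for c
    proof -
      obtain k :: nat where k: "c = y [^]\<^bsub>K\<^esub> k" using carrier_K_nat \<open>c \<in> carrier K\<close> by blast
      have "a - 1 dvd a ^ k - 1" using power_diff_1_eq[of a k] by simp
      hence "(a - 1) * (h * int (p ^ m)) dvd (a ^ k - 1) * (h * int (p ^ m))"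
        by (rule mult_dvd_mono) simp
      moreover have "N dvd (a - 1) * (h * int (p ^ m))"
        by (simp add: N_def h r mult_ac)
      ultimately have "N dvd (a ^ k - 1) * (h * int (p ^ m))" by (rule dvd_trans[rotated])
      hence "[a ^ k * (h * int (p ^ m)) = h * int (p ^ m)] (mod N)"
        by (simp add: cong_iff_dvd_diff left_diff_distrib)
      thus ?thesis unfolding k w_def \<alpha>_pow x_eq .
    qed
    hence "fst w = \<one>\<^bsub>integer_mod_group n\<^esub>"
      using act fst_w w_eq unfolding smc_action_def K_def by metis
    hence "w = \<one>\<^bsub>H\<^esub>"
      using w_eq by (simp add: H_def)
    hence "x [^]\<^bsub>H\<^esub> (h * int (p ^ m)) = x [^]\<^bsub>H\<^esub> (0::int)" by (simp add: w_def)
    hence "g * (h * int (p ^ m)) dvd 1 * (h * int (p ^ m))"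
      unfolding x_eq by (simp add: N_def h cong_0_iff mult_ac)
    moreover have "h * int (p ^ m) \<noteq> 0" using h n p_pos by auto
    ultimately have "g dvd 1" by (subst (asm) dvd_mult_cancel_right) auto
    thus ?thesis unfolding g_def by (simp only: is_unit_gcd)
  qed
  have a_pred: "[a - 1 = int (\<beta> * p ^ (m - 1))] (mod int (p ^ m))"
    using cong_diff[OF a cong_refl[of 1]] by simp
  have pred_dvd: "int (p ^ (m - 1)) dvd a - 1"
  proof -
    have "[a - 1 = int (\<beta> * p ^ (m - 1))] (mod int (p ^ (m - 1)))"
      using a_pred by (rule cong_dvd_modulus) (simp add: le_imp_power_dvd)
    thus ?thesis by (simp add: cong_dvd_iff)
  qed
  have pred_not_dvd: "\<not> int (p ^ m) dvd a - 1"
  proof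
    assume "int (p ^ m) dvd a - 1"
    hence "int (p ^ m) dvd int (\<beta> * p ^ (m - 1))"
      using a_pred by (metis cong_dvd_iff)
    hence "p ^ m dvd \<beta> * p ^ (m - 1)" by (simp only: int_dvd_int_iff)
    moreover have "p ^ m = p * p ^ (m - 1)" using m by (cases m) auto
    ultimately have "p dvd \<beta>" using p_pos by simp
    thus False using \<beta> by (auto dest: dvd_imp_le)
  qed
  have unit: "unit_of_order_p n m p a"
  proof
    show "coprime n p" by (fact coprime_np)
  qed (use p n m m3 power_p free pred_dvd pred_not_dvd N_def in simp_all)
  have smc: "smc n m p \<alpha> = semidirect_product H K \<alpha>"
    by (simp add: smc_def H_def K_def)
  have "group (semidirect_product H K \<alpha>)"
    using H.is_group K.comm_group_axioms hom by (rule group_semidirect_product)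
  moreover have "metacyclic_group_axioms n m p a (semidirect_product H K \<alpha>)
      (\<lambda>i j. (x [^]\<^bsub>H\<^esub> i, z [^]\<^bsub>K\<^esub> j))"
  proof
    show "carrier (semidirect_product H K \<alpha>) = range (\<lambda>(i, j). (x [^]\<^bsub>H\<^esub> (i::int), z [^]\<^bsub>K\<^esub> (j::nat)))"
    proof (intro equalityI subsetI)
      fix g assume "g \<in> carrier (semidirect_product H K \<alpha>)"
      then obtain u c where g: "g = (u, c)" "u \<in> carrier H" "c \<in> carrier K"
        by (auto simp: semidirect_product_def)
      obtain k :: nat where "inv\<^bsub>K\<^esub> c = y [^]\<^bsub>K\<^esub> k"
        using carrier_K_nat g(3) by blast
      hence "c = z [^]\<^bsub>K\<^esub> k"
        unfolding z_def using g(3) by (metis K.inv_inv K.nat_pow_inv yK)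
      moreover obtain i :: int where "u = x [^]\<^bsub>H\<^esub> i" using g(2) carrier_H by blast
      ultimately show "g \<in> range (\<lambda>(i, j). (x [^]\<^bsub>H\<^esub> (i::int), z [^]\<^bsub>K\<^esub> (j::nat)))"
        unfolding g(1) by (intro image_eqI[of _ _ "(i, k)"]) auto
    qed (auto simp: semidirect_product_def)
  next
    fix i k :: int and j l :: nat
    show "(x [^]\<^bsub>H\<^esub> i, z [^]\<^bsub>K\<^esub> j) = (x [^]\<^bsub>H\<^esub> k, z [^]\<^bsub>K\<^esub> l) \<longleftrightarrow>
        [i = k] (mod int (n * p ^ m)) \<and> [j = l] (mod p)"
      by (simp only: prod.inject x_eq z_eq N_def)
  next
    fix i k :: int and j l :: nat
    have "inv\<^bsub>K\<^esub> (z [^]\<^bsub>K\<^esub> j) = y [^]\<^bsub>K\<^esub> j"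
      unfolding z_def by (simp add: K.nat_pow_inv)
    thus "(x [^]\<^bsub>H\<^esub> i, z [^]\<^bsub>K\<^esub> j) \<otimes>\<^bsub>semidirect_product H K \<alpha>\<^esub> (x [^]\<^bsub>H\<^esub> k, z [^]\<^bsub>K\<^esub> l) =
        (x [^]\<^bsub>H\<^esub> (i + a ^ j * k), z [^]\<^bsub>K\<^esub> (j + l))"
      by (simp add: semidirect_product_def \<alpha>_pow H.int_pow_mult K.nat_pow_mult)
  qed
  ultimately show ?thesis
    unfolding smc H_def[symmetric] K_def[symmetric] z_def[symmetric]
    using unit by (simp add: metacyclic_group_def)
qed

theorem theorem4p2p3:
  fixes n m p \<beta> :: nat
    and \<alpha> :: "int \<Rightarrow> int \<times> int \<Rightarrow> int \<times> int"
    and x :: "int \<times> int" and y a :: int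
  assumes "n \<ge> 2" and "m \<ge> 2" and "Factorial_Ring.prime p" and "gcd n p = 1"
    and "p = 2 \<Longrightarrow> m \<ge> 3"
    and "smc_action n m p \<alpha>"
    and "x \<in> carrier (smc_base n m p)"
    and "generate (smc_base n m p) {x} = carrier (smc_base n m p)"
    and "y \<in> carrier (integer_mod_group p)"
    and "generate (integer_mod_group p) {y} = carrier (integer_mod_group p)"
    and "\<alpha> y x = x [^]\<^bsub>smc_base n m p\<^esub> a"
    and "\<beta> \<in> {1..p - 1}"
    and "[a = int (\<beta> * p ^ (m - 1) + 1)] (mod int (p ^ m))"
  shows
    "(odd p \<longrightarrow>
        (of_nat ` reidemeister_spectrum (smc n m p \<alpha>) :: rat set) =
          {of_nat p powi (int e + 1) + of_nat p powi (int e - 1) * (of_nat (sum_list d) - of_nat p) | e d.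
             0 \<le> e \<and> e \<le> m - 1 \<and> d \<in> coprime_divisor_tuples (n * p) p \<and>
             ([prod_list d = 0] (mod p) \<longleftrightarrow> e = m - 1)}) \<and>
     (p = 2 \<and> \<not> [n = 0] (mod 3) \<longrightarrow>
        (of_nat ` reidemeister_spectrum (smc n m p \<alpha>) :: rat set) =
          {2 powi (int e + 1) + 2 powi (int e - 1) * (of_nat (sum_list d) - 2) | e d.
             1 \<le> e \<and> e \<le> m - 1 \<and> d \<in> coprime_divisor_tuples (2 * n) 2 \<and>
             ([prod_list d = 0] (mod 2) \<longleftrightarrow> e = m - 1)}) \<and>
     (p = 2 \<and> [n = 0] (mod 3) \<longrightarrow>
        (of_nat ` reidemeister_spectrum (smc n m p \<alpha>) :: rat set) =
          {2 powi (int e + 1) + 2 powi (int e - 1) * (of_nat (sum_list d) - 2) | e d.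
             1 \<le> e \<and> e \<le> m - 1 \<and> d \<in> coprime_divisor_tuples3 (2 * n) 2 \<and>
             ([prod_list d = 0] (mod 2) \<longleftrightarrow> e = m - 1)})"
proof -
  interpret metacyclic_group n m p a "smc n m p \<alpha>"
    "\<lambda>i j. (x [^]\<^bsub>smc_base n m p\<^esub> i, (inv\<^bsub>integer_mod_group p\<^esub> y) [^]\<^bsub>integer_mod_group p\<^esub> j)"
    using assms by (rule metacyclic_group_smc)
  note spectrum = of_nat_reidemeister_spectrum[unfolded admissible_iff]
  have two: "(of_nat 2 :: rat) = 2" by simp
  show ?thesis
  proof (intro conjI impI; (elim conjE)?)
    assume "odd p"
    hence "p \<noteq> 2" by auto
    thus "(of_nat ` reidemeister_spectrum (smc n m p \<alpha>) :: rat set) =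
          {of_nat p powi (int e + 1) + of_nat p powi (int e - 1) * (of_nat (sum_list d) - of_nat p) | e d.
             0 \<le> e \<and> e \<le> m - 1 \<and> d \<in> coprime_divisor_tuples (n * p) p \<and>
             ([prod_list d = 0] (mod p) \<longleftrightarrow> e = m - 1)}"
      using spectrum by (simp only: le0 simp_thms if_False)
  next
    assume "p = 2" "\<not> [n = 0] (mod 3)"
    thus "(of_nat ` reidemeister_spectrum (smc n m p \<alpha>) :: rat set) =
          {2 powi (int e + 1) + 2 powi (int e - 1) * (of_nat (sum_list d) - 2) | e d.
             1 \<le> e \<and> e \<le> m - 1 \<and> d \<in> coprime_divisor_tuples (2 * n) 2 \<and>
             ([prod_list d = 0] (mod 2) \<longleftrightarrow> e = m - 1)}"
      using spectrum by (simp only: two mult.commute[of 2 n] simp_thms if_False conj_left_commute[of "1 \<le> _"])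
  next
    assume "p = 2" "[n = 0] (mod 3)"
    thus "(of_nat ` reidemeister_spectrum (smc n m p \<alpha>) :: rat set) =
          {2 powi (int e + 1) + 2 powi (int e - 1) * (of_nat (sum_list d) - 2) | e d.
             1 \<le> e \<and> e \<le> m - 1 \<and> d \<in> coprime_divisor_tuples3 (2 * n) 2 \<and>
             ([prod_list d = 0] (mod 2) \<longleftrightarrow> e = m - 1)}"
      using spectrum by (simp only: two mult.commute[of 2 n] simp_thms if_True conj_left_commute[of "1 \<le> _"])
  qed
qed

end
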